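(* Let $\alpha\in(1,2]$, let $n\ge 1$ be an integer, and let $H:\mathbb{R}\to\mathbb{R}$ satisfy: (a) there are constants $a,b$ with $n-1<a\le H(t)\le b<n$ for all $t\in\mathbb{R}$; (b) there are $\beta>0$ and $C_H>0$ with $|H(t)-H(s)|\le C_H|t-s|^\beta$ for all $s,t\in\mathbb{R}$. Let $f_n(t,u)=f_n(t,u;H,\alpha)$ be the regularized kernel and $X^{(n)}_H(t)=\int_{\mathbb{R}}f_n(t,u)\,dM_\alpha(u)$ the $n$-th order multifractional stable motion defined in the context. Then: (i) For each $t\in\mathbb{R}$, $f_n(t,\cdot)\in L^\alpha(\mathbb{R})$, so $X^{(n)}_H(t)$ is a well-defined S$\alpha$S random variable. (ii) For any $m\ge1$, $t_1,\dots,t_m\in\mathbb{R}$ and $\theta_1,\dots,\theta_m\in\mathbb{R}$, $$\mathbb{E}\Bigl[\exp\Bigl(i\sum_{j=1}^m\theta_jX^{(n)}_H(t_j)\Bigr)\Bigr]=\exp\Bigl(-\int_{\mathbb{R}}\Bigl|\sum_{j=1}^m\theta_jf_n(t_j,u)\Bigr|^\alpha du\Bigr).$$ (iii) For any $t_1,\dots,t_m$ and $\theta_1,\dots,\theta_m\in\mathbb{R}$, $\sum_{j=1}^m\theta_jX^{(n)}_H(t_j)$ is S$\alpha$S; in particular $(X^{(n)}_H(t_1),\dots,X^{(n)}_H(t_m))$ is a jointly S$\alpha$S random vector. (iv) $\|X^{(n)}_H(t)\|_\alpha^\alpha=\int_{\mathbb{R}}|f_n(t,u)|^\alpha\,du<\infty$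 for each $t\in\mathbb{R}$. (v) For $h\in\mathbb{R}$ let $\Delta^n_hX^{(n)}_H(t):=\sum_{k=0}^n(-1)^{n-k}\binom nk X^{(n)}_H(t+kh)$. If $H$ is constant ($H(t)\equiv H\in(n-1,n)$), then the process $t\mapsto\Delta^n_hX^{(n)}_H(t)$ is stationary in $t$. For functional $H(\cdot)$, the distribution of $\Delta^n_hX^{(n)}_H(t)$ depends on $t$ only through the values $H(t),H(t+h),\dots,H(t+nh)$.
   Context: A real random variable $\xi$ is symmetric $\alpha$-stable (S$\alpha$S) with scale $\|\xi\|_\alpha:=\sigma\ge0$ if $\mathbb{E}[e^{i\theta\xi}]=e^{-\sigma^\alpha|\theta|^\alpha}$ for all $\theta\in\mathbb{R}$. $M_\alpha$ denotes an S$\alpha$S random measure on $\mathbb{R}$ with Lebesgue control measure $\lambda$: for Borel $A$ with $\lambda(A)<\infty$, $\mathbb{E}[e^{i\theta M_\alpha(A)}]=e^{-|\theta|^\alpha\lambda(A)}$; $M_\alpha$ is independently scattered (values on pairwise disjoint sets are independent) and almost surely countably additive on disjoint sets whose union has finite measure. For $f\in L^\alpha(\mathbb{R})$ the integral $\int f\,dM_\alpha$ is the usual stable stochastic integral (extension from simple functions), an S$\alpha$S variable with scale $\|f\|_{L^\alpha}$, linear in $f$. Put $\gamma(t):=H(t)-1/\alpha$, $x_+:=\max\{x,0\}$ with $0_+^0:=1$; empty products equal $1$. The regularized kernel is $$f_n(t,u;H,\alpha):=\frac1{\Gamma(\gamma(t)+1)}\Bigl[(t-u)_+^{\gamma(t)}-\sum_{k=0}^{n-1}\frac{t^k}{k!}(-u)_+^{\gamma(t)-k}\prod_{j=0}^{k-1}(\gamma(t)-j)\Bigr],\quad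 t,u\in\mathbb{R}.$$ The $n$-th order multifractional stable motion ($n$-MFSM) is $X^{(n)}_H(t):=\int_{\mathbb{R}}f_n(t,u;H,\alpha)\,dM_\alpha(u)$, $t\in\mathbb{R}$.
   Formalization: The last claim of (v) is false for general H; proved instead: at a fixed t the law depends on H only through H(t),...,H(t+nh), and for different times equal grid values give equal laws if H(t)=...=H(t+nh). Also x_+^0 is taken as 0 for x<0. *)

theory Defs
  imports "HOL-Probability.Probability"
begin

section \<open>Symmetric stable random variables and vectors\<close>

definition SaS_with_scale :: "'a measure \<Rightarrow> real \<Rightarrow> real \<Rightarrow> ('a \<Rightarrow> real) \<Rightarrow> bool" where
  "SaS_with_scale P \<alpha> \<sigma> \<xi> \<longleftrightarrow> \<xi> \<in> borel_measurable P \<and> 0 \<le> \<sigma> \<and>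
    (\<forall>\<theta>. (CLINT \<omega>|P. iexp (\<theta> * \<xi> \<omega>)) =
      complex_of_real (exp (- (\<sigma> powr \<alpha> * \<bar>\<theta>\<bar> powr \<alpha>))))"

definition SaS :: "'a measure \<Rightarrow> real \<Rightarrow> ('a \<Rightarrow> real) \<Rightarrow> bool" where
  "SaS P \<alpha> \<xi> \<longleftrightarrow> (\<exists>\<sigma>. SaS_with_scale P \<alpha> \<sigma> \<xi>)"

definition SaS_scale :: "'a measure \<Rightarrow> real \<Rightarrow> ('a \<Rightarrow> real) \<Rightarrow> real" where
  "SaS_scale P \<alpha> \<xi> = (THE \<sigma>. SaS_with_scale P \<alpha> \<sigma> \<xi>)"

definition joint_law :: "'a measure \<Rightarrow> 'i set \<Rightarrow> ('i \<Rightarrow> 'a \<Rightarrow> real) \<Rightarrow> ('i \<Rightarrow> real) measure" where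
  "joint_law P J \<xi> = distr P (\<Pi>\<^sub>M j\<in>J. borel) (\<lambda>\<omega>. \<lambda>j\<in>J. \<xi> j \<omega>)"

text \<open>A vector is symmetric \<open>\<alpha>\<close>-stable if its law is symmetric and, for independent copies
  \<open>\<xi>'\<close>, \<open>\<xi>''\<close> of it (realised on the product space) and all \<open>A, B > 0\<close>, the vector
  \<open>A \<xi>' + B \<xi>''\<close> has the law of \<open>(A\<^sup>\<alpha> + B\<^sup>\<alpha>)\<^bsup>1/\<alpha>\<^esup> \<xi>\<close>. By symmetry there is no shift term.\<close>

definition jointly_SaS :: "'a measure \<Rightarrow> real \<Rightarrow> 'i set \<Rightarrow> ('i \<Rightarrow> 'a \<Rightarrow> real) \<Rightarrow> bool" where
  "jointly_SaS P \<alpha> J \<xi> \<longleftrightarrow>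
    (\<forall>j\<in>J. \<xi> j \<in> borel_measurable P) \<and>
    joint_law P J (\<lambda>j \<omega>. - \<xi> j \<omega>) = joint_law P J \<xi> \<and>
    (\<forall>A>0. \<forall>B>0.
      joint_law (P \<Otimes>\<^sub>M P) J (\<lambda>j (\<omega>', \<omega>''). A * \<xi> j \<omega>' + B * \<xi> j \<omega>'') =
      joint_law P J (\<lambda>j \<omega>. (A powr \<alpha> + B powr \<alpha>) powr (1 / \<alpha>) * \<xi> j \<omega>))"

definition stationary_process :: "'a measure \<Rightarrow> (real \<Rightarrow> 'a \<Rightarrow> real) \<Rightarrow> bool" where
  "stationary_process P Y \<longleftrightarrow>
    (\<forall>t. Y t \<in> borel_measurable P) \<and>
    (\<forall>J \<tau>. finite J \<longrightarrow> joint_law P J (\<lambda>t. Y (t + \<tau>)) = joint_law P J Y)"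


section \<open>Symmetric stable random measures and stable integrals\<close>

definition finite_borel_sets :: "real set set" where
  "finite_borel_sets = {A \<in> sets borel. emeasure lborel A < \<infinity>}"

locale SaS_random_measure = prob_space P for P :: "'a measure" +
  fixes \<alpha> :: real and M :: "real set \<Rightarrow> 'a \<Rightarrow> real"
  assumes random_variable_M: "A \<in> finite_borel_sets \<Longrightarrow> M A \<in> borel_measurable P"
    and char_M: "A \<in> finite_borel_sets \<Longrightarrow>
      (CLINT \<omega>|P. iexp (\<theta> * M A \<omega>)) =
        complex_of_real (exp (- (\<bar>\<theta>\<bar> powr \<alpha> * measure lborel A)))"
    and independently_scattered:
      "\<lbrakk>\<And>i. i \<in> I \<Longrightarrow> S i \<in> finite_borel_sets; disjoint_family_on S (I :: nat set)\<rbrakk>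
        \<Longrightarrow> indep_vars (\<lambda>_. borel) (\<lambda>i. M (S i)) I"
    and countably_additive_M:
      "\<lbrakk>\<And>i :: nat. S i \<in> finite_borel_sets; disjoint_family S; (\<Union>i. S i) \<in> finite_borel_sets\<rbrakk>
        \<Longrightarrow> AE \<omega> in P. (\<lambda>i. M (S i) \<omega>) sums M (\<Union>i. S i) \<omega>"

definition L_alpha :: "real \<Rightarrow> (real \<Rightarrow> real) set" where
  "L_alpha \<alpha> = {f \<in> borel_measurable lborel. integrable lborel (\<lambda>u. \<bar>f u\<bar> powr \<alpha>)}"

definition tendsto_in_probability ::
    "'a measure \<Rightarrow> (nat \<Rightarrow> 'a \<Rightarrow> real) \<Rightarrow> ('a \<Rightarrow> real) \<Rightarrow> bool" where
  "tendsto_in_probability P Z Y \<longleftrightarrow>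
    (\<forall>\<epsilon>>0. (\<lambda>k. measure P {\<omega> \<in> space P. \<epsilon> < \<bar>Z k \<omega> - Y \<omega>\<bar>}) \<longlonglongrightarrow> 0)"

definition simple_stable_integral ::
    "(real set \<Rightarrow> 'a \<Rightarrow> real) \<Rightarrow> (real \<Rightarrow> real) \<Rightarrow> 'a \<Rightarrow> real" where
  "simple_stable_integral M \<phi> \<omega> = (\<Sum>y\<in>range \<phi> - {0}. y * M (\<phi> -` {y}) \<omega>)"

text \<open>The integral of \<open>f\<close> is a limit in probability of the integrals of simple functions
  (measurable, finitely many values, support of finite measure) that converge to \<open>f\<close> in
  \<open>L\<^sup>\<alpha>\<close>. As such a limit is determined only up to a null event, the integral is introduced
  as a relation; \<open>stable_integral\<close> picks a version.\<close>

definition has_stable_integral ::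
    "'a measure \<Rightarrow> real \<Rightarrow> (real set \<Rightarrow> 'a \<Rightarrow> real) \<Rightarrow> (real \<Rightarrow> real) \<Rightarrow> ('a \<Rightarrow> real) \<Rightarrow> bool" where
  "has_stable_integral P \<alpha> M f Y \<longleftrightarrow>
    f \<in> L_alpha \<alpha> \<and> Y \<in> borel_measurable P \<and>
    (\<exists>\<phi> :: nat \<Rightarrow> real \<Rightarrow> real.
      (\<forall>k. Bochner_Integration.simple_bochner_integrable lborel (\<phi> k)) \<and>
      (\<lambda>k. LINT u|lborel. \<bar>\<phi> k u - f u\<bar> powr \<alpha>) \<longlonglongrightarrow> 0 \<and>
      tendsto_in_probability P (\<lambda>k. simple_stable_integral M (\<phi> k)) Y)"

definition stable_integral ::
    "'a measure \<Rightarrow> real \<Rightarrow> (real set \<Rightarrow> 'a \<Rightarrow> real) \<Rightarrow> (real \<Rightarrow> real) \<Rightarrow> 'a \<Rightarrow> real" where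
  "stable_integral P \<alpha> M f = (SOME Y. has_stable_integral P \<alpha> M f Y)"


section \<open>Multifractional stable motion of order n\<close>

text \<open>The truncated power \<open>x\<^sub>+\<^bsup>p\<^esup>\<close>: it vanishes for \<open>x < 0\<close> also when \<open>p = 0\<close>, and the
  convention \<open>0\<^sub>+\<^bsup>0\<^esup> = 1\<close> concerns the point \<open>x = 0\<close> only. (If \<open>x\<^sub>+\<^bsup>0\<^esup>\<close> were \<open>1\<close> for
  all \<open>x < 0\<close>, the kernel below would fail to be in \<open>L\<^sup>\<alpha>\<close> for \<open>n \<ge> 2\<close> and
  \<open>H(t) = n - 1 + 1/\<alpha>\<close>.) For \<open>p < 0\<close> the value at \<open>0\<close> is set to \<open>0\<close>; this affects
  the kernel on a null set only.\<close>

definition pos_power :: "real \<Rightarrow> real \<Rightarrow> real" where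
  "pos_power x p = (if 0 < x then x powr p else if x = 0 \<and> p = 0 then 1 else 0)"

definition mfsm_kernel :: "nat \<Rightarrow> real \<Rightarrow> (real \<Rightarrow> real) \<Rightarrow> real \<Rightarrow> real \<Rightarrow> real" where
  "mfsm_kernel n \<alpha> H t u =
    (let \<gamma> = H t - 1 / \<alpha> in
      1 / Gamma (\<gamma> + 1) *
        (pos_power (t - u) \<gamma> -
         (\<Sum>k<n. t ^ k / fact k * pos_power (- u) (\<gamma> - real k) * (\<Prod>j<k. \<gamma> - real j))))"

definition mfsm ::
    "'a measure \<Rightarrow> real \<Rightarrow> (real set \<Rightarrow> 'a \<Rightarrow> real) \<Rightarrow> nat \<Rightarrow> (real \<Rightarrow> real) \<Rightarrow> real \<Rightarrow> 'a \<Rightarrow> real" where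
  "mfsm P \<alpha> M n H t = stable_integral P \<alpha> M (mfsm_kernel n \<alpha> H t)"

definition Hurst_function :: "nat \<Rightarrow> (real \<Rightarrow> real) \<Rightarrow> bool" where
  "Hurst_function n H \<longleftrightarrow>
    (\<exists>a b. real n - 1 < a \<and> (\<forall>t. a \<le> H t \<and> H t \<le> b) \<and> b < real n) \<and>
    (\<exists>\<beta>>0. \<exists>C>0. \<forall>s t. \<bar>H t - H s\<bar> \<le> C * \<bar>t - s\<bar> powr \<beta>)"

definition nth_increment :: "nat \<Rightarrow> real \<Rightarrow> (real \<Rightarrow> 'a \<Rightarrow> real) \<Rightarrow> real \<Rightarrow> 'a \<Rightarrow> real" where
  "nth_increment n h X t \<omega> =
    (\<Sum>k\<le>n. (- 1) ^ (n - k) * real (n choose k) * X (t + real k * h) \<omega>)"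

end

theory Submission
  imports Defs
begin

text \<open>
  Everything reduces to characteristic functions of finite linear combinations of stable
  integrals. For a simple \<open>\<phi>\<close>, independence of \<open>M\<close> over the level sets of \<open>\<phi>\<close> shows that
  \<open>\<integral>\<phi> dM\<close> has characteristic function \<open>exp (-\<bar>\<theta>\<bar>\<^sup>\<alpha> \<integral>\<bar>\<phi>\<bar>\<^sup>\<alpha>)\<close>, and additivity of \<open>M\<close> makes the
  integral almost surely linear. Averaging that characteristic function against a Gaussian
  weight bounds \<open>P (\<epsilon> < \<bar>\<integral>\<phi> dM\<bar>)\<close> by a multiple of \<open>\<integral>\<bar>\<phi>\<bar>\<^sup>\<alpha>\<close> (\<open>stable_tail_bound\<close>). Thus
  integration is continuous from \<open>L\<^sup>\<alpha>\<close> to convergence in probability. Existence of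
  the integral follows by Borel-Cantelli along a rapidly converging sequence of simple
  functions, uniqueness follows because an integral of \<open>0\<close> vanishes almost surely, and both
  linearity and the formula for the characteristic function survive the limit
  (\<open>has_stable_integral_lincomb\<close>, \<open>char_stable_integral\<close>).

  This applies to the motion since its kernel lies in \<open>L\<^sup>\<alpha>\<close> (\<open>mfsm_kernel_in_L_alpha\<close>). With
  \<open>p = H t - 1/\<alpha>\<close>, the singularities at \<open>t\<close> and \<open>0\<close> are powers of exponent at least
  \<open>p - (n - 1)\<close>, which are \<open>\<alpha>\<close>-integrable there because \<open>n - 1 < H t\<close>. For \<open>u\<close> tending to
  \<open>-\<infinity>\<close> the subtracted sum is the binomial expansion of \<open>(t - u)\<^bsup>p\<^esup>\<close> in powers of \<open>t / (-u)\<close>,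
  cut off before order \<open>n\<close>, so the kernel is of order \<open>\<bar>u\<bar>\<^bsup>p - n\<^esup>\<close>, which is \<open>\<alpha>\<close>-integrable
  because \<open>H t < n\<close>.

  Joint stability and stationarity are equalities of laws of random vectors. They follow from
  equality of characteristic functions by the uniqueness theorem in several dimensions
  (\<open>joint_law_eqI_char\<close>), which is obtained from Levy's theorem on the line by treating
  the coordinates one after the other. For stationarity, the binomial
  difference of order \<open>n\<close> kills every polynomial in \<open>t\<close> of degree below \<open>n\<close>, in particular
  the subtracted sum in the kernel. What remains is a function of \<open>u - t\<close> when \<open>H\<close> is
  constant along the grid, and Lebesgue measure is invariant under translation.
\<close>


section \<open>The space \<open>L\<^sup>\<alpha>\<close>\<close>

text \<open>A substitute for the triangle inequality: it serves every \<open>\<alpha> > 0\<close> and is all that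
  convergence arguments in \<open>L\<^sup>\<alpha>\<close> need.\<close>

lemma abs_add_powr_le:
  fixes x y :: real
  assumes "0 < \<alpha>"
  shows "\<bar>x + y\<bar> powr \<alpha> \<le> 2 powr \<alpha> * (\<bar>x\<bar> powr \<alpha> + \<bar>y\<bar> powr \<alpha>)"
proof -
  have "\<bar>x + y\<bar> powr \<alpha> \<le> (2 * max \<bar>x\<bar> \<bar>y\<bar>) powr \<alpha>"
    using assms by (intro powr_mono2) auto
  also have "\<dots> = 2 powr \<alpha> * max \<bar>x\<bar> \<bar>y\<bar> powr \<alpha>" by (simp add: powr_mult)
  also have "\<dots> \<le> 2 powr \<alpha> * (\<bar>x\<bar> powr \<alpha> + \<bar>y\<bar> powr \<alpha>)"
    by (intro mult_left_mono) (auto simp: max_def)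
  finally show ?thesis .
qed

lemma L_alpha_measurable: "f \<in> L_alpha \<alpha> \<Longrightarrow> f \<in> borel_measurable borel"
  and L_alpha_integrable: "f \<in> L_alpha \<alpha> \<Longrightarrow> integrable lborel (\<lambda>u. \<bar>f u\<bar> powr \<alpha>)"
  by (auto simp: L_alpha_def)

lemma L_alphaI_dominated:
  assumes "f \<in> borel_measurable borel" "integrable lborel g" "AE u in lborel. \<bar>f u\<bar> powr \<alpha> \<le> g u"
  shows "f \<in> L_alpha \<alpha>"
proof -
  have "integrable lborel (\<lambda>u. \<bar>f u\<bar> powr \<alpha>)"
    by (rule Bochner_Integration.integrable_bound[OF assms(2)]) (use assms in auto)
  then show ?thesis using assms by (simp add: L_alpha_def)
qed

lemma L_alpha_add:
  assumes "0 < \<alpha>" and f: "f \<in> L_alpha \<alpha>" and g: "g \<in> L_alpha \<alpha>"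
  shows "(\<lambda>u. f u + g u) \<in> L_alpha \<alpha>"
  using L_alpha_measurable[OF f] L_alpha_measurable[OF g] L_alpha_integrable[OF f] L_alpha_integrable[OF g]
  by (intro L_alphaI_dominated[where g="\<lambda>u. 2 powr \<alpha> * (\<bar>f u\<bar> powr \<alpha> + \<bar>g u\<bar> powr \<alpha>)"])
     (auto intro!: abs_add_powr_le assms(1))

lemma L_alpha_cmult:
  assumes f: "f \<in> L_alpha \<alpha>"
  shows "(\<lambda>u. c * f u) \<in> L_alpha \<alpha>"
  using L_alpha_measurable[OF f] L_alpha_integrable[OF f]
  by (auto simp: L_alpha_def abs_mult powr_mult)

lemma L_alpha_sum:
  assumes "0 < \<alpha>" "\<And>i. i \<in> I \<Longrightarrow> f i \<in> L_alpha \<alpha>"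
  shows "(\<lambda>u. \<Sum>i\<in>I. f i u) \<in> L_alpha \<alpha>"
  using assms(2)
proof (induction I rule: infinite_finite_induct)
  case (insert i I)
  then show ?case using L_alpha_add[OF assms(1), of "f i" "\<lambda>u. \<Sum>i\<in>I. f i u"] by auto
qed (auto simp: L_alpha_def)

text \<open>The \<open>\<alpha>\<close>-th power of the norm of \<open>L\<^sup>\<alpha>\<close>. It occurs without a root in every characteristic function.\<close>

definition L_alpha_modular :: "real \<Rightarrow> (real \<Rightarrow> real) \<Rightarrow> real" where
  "L_alpha_modular \<alpha> f = (LINT u|lborel. \<bar>f u\<bar> powr \<alpha>)"

lemma L_alpha_modular_nonneg: "0 \<le> L_alpha_modular \<alpha> f"
  by (simp add: L_alpha_modular_def)

lemma L_alpha_modular_diff_le: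
  assumes "0 < \<alpha>" and f: "f \<in> L_alpha \<alpha>" and g: "g \<in> L_alpha \<alpha>"
  shows "L_alpha_modular \<alpha> (\<lambda>u. f u - g u) \<le> 2 powr \<alpha> * (L_alpha_modular \<alpha> f + L_alpha_modular \<alpha> g)"
proof -
  have d: "(\<lambda>u. f u - g u) \<in> L_alpha \<alpha>"
    using L_alpha_add[OF assms(1) f L_alpha_cmult[OF g, of "-1"]] by simp
  have "L_alpha_modular \<alpha> (\<lambda>u. f u - g u) \<le> (LINT u|lborel. 2 powr \<alpha> * (\<bar>f u\<bar> powr \<alpha> + \<bar>g u\<bar> powr \<alpha>))"
    unfolding L_alpha_modular_def
    using abs_add_powr_le[OF assms(1), of "f _" "- g _"]
      L_alpha_integrable[OF f] L_alpha_integrable[OF g] L_alpha_integrable[OF d]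
    by (intro integral_mono) auto
  then show ?thesis
    using L_alpha_integrable[OF f] L_alpha_integrable[OF g] by (simp add: L_alpha_modular_def)
qed

lemma L_alpha_modular_cmult: "L_alpha_modular \<alpha> (\<lambda>u. c * f u) = \<bar>c\<bar> powr \<alpha> * L_alpha_modular \<alpha> f"
  by (simp add: L_alpha_modular_def abs_mult powr_mult)

section \<open>Integrability of the kernel\<close>

lemma integrable_powr_near_0:
  assumes "-1 < e" "0 \<le> B"
  shows "integrable lborel (\<lambda>v::real. indicator {0..B} v * v powr e)"
proof -
  have "set_integrable lebesgue {0..B} (\<lambda>v. v powr e)"
    using integrable_on_powr_from_0[OF assms] by (intro nonnegative_absolutely_integrable_1) auto
  then show ?thesis
    unfolding set_integrable_def by (subst (asm) integrable_completion) auto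
qed

lemma integrable_powr_at_infinity:
  assumes "e < -1" "0 < B"
  shows "integrable lborel (\<lambda>v::real. indicator {B..} v * v powr e)"
proof -
  have "(\<lambda>v. v powr e) integrable_on {B..}"
    using has_integral_powr_to_inf[OF assms] by (auto simp: integrable_on_def)
  then have "set_integrable lebesgue {B..} (\<lambda>v. v powr e)"
    by (intro nonnegative_absolutely_integrable_1) auto
  then show ?thesis
    unfolding set_integrable_def by (subst (asm) integrable_completion) auto
qed

lemma pos_power_measurable [measurable]: "(\<lambda>u. pos_power (f u) p) \<in> borel_measurable M"
  if [measurable]: "f \<in> borel_measurable M"
  unfolding pos_power_def by measurable

text \<open>After reflection at \<open>c\<close> the \<open>\<alpha>\<close>-th power of the function is below \<open>v\<^bsup>p\<alpha>\<^esup>\<close> on a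
  bounded interval starting at \<open>0\<close>.\<close>

lemma truncated_pos_power_in_L_alpha:
  assumes "-1 < p * \<alpha>"
  shows "(\<lambda>u. indicator {-R..R} u * pos_power (c - u) p) \<in> L_alpha \<alpha>"
proof (rule L_alphaI_dominated)
  let ?g = "\<lambda>v::real. indicator {0..\<bar>c\<bar> + \<bar>R\<bar>} v * v powr (p * \<alpha>)"
  show "integrable lborel (\<lambda>u. ?g (c + (-1) * u))"
    by (intro lborel_integrable_real_affine integrable_powr_near_0 assms) auto
  show "AE u in lborel. \<bar>indicator {-R..R} u * pos_power (c - u) p\<bar> powr \<alpha> \<le> ?g (c + (-1) * u)"
    using AE_lborel_singleton[of c]
    by eventually_elim (auto simp: pos_power_def indicator_def powr_powr)
qed measurable

text \<open>The remainder is the tail of the binomial series. Taking out \<open>x\<^sup>n\<close> leaves a power series that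
  converges absolutely at \<open>1/2\<close>, since the radius of convergence is at least \<open>1\<close>.\<close>

lemma binomial_remainder_bound:
  fixes x p :: real
  assumes "\<bar>x\<bar> \<le> 1/2"
  shows "\<bar>(1 + x) powr p - (\<Sum>k<n. (p gchoose k) * x ^ k)\<bar> \<le> \<bar>x\<bar> ^ n * (\<Sum>k. \<bar>p gchoose (k + n)\<bar> * (1/2) ^ k)"
proof -
  have s: "(\<lambda>k. (p gchoose k) * x ^ k) sums (1 + x) powr p"
    using assms by (intro gen_binomial_real) auto
  \<comment> \<open>convergence at \<open>3/4\<close> implies absolute convergence at \<open>1/2\<close>\<close>
  have "summable (\<lambda>k. (p gchoose k) * (3/4) ^ k)"
    using gen_binomial_real[of "3/4" p] by (auto simp: sums_iff)
  then have "summable (\<lambda>k. norm ((p gchoose k) * (1/2) ^ k))"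
    by (rule powser_insidea) auto
  then have "summable (\<lambda>k. \<bar>p gchoose (k + n)\<bar> * (1/2) ^ (k + n))"
    using summable_ignore_initial_segment[of "\<lambda>k. \<bar>p gchoose k\<bar> * (1/2) ^ k" n]
    by (simp add: abs_mult power_abs)
  then have "summable (\<lambda>k. 2 ^ n * (\<bar>p gchoose (k + n)\<bar> * (1/2) ^ (k + n)))"
    by (rule summable_mult)
  then have major: "summable (\<lambda>k. \<bar>p gchoose (k + n)\<bar> * (1/2) ^ k)"
    by (simp add: power_add power_one_over field_simps)
  have le: "norm ((p gchoose (k + n)) * x ^ k) \<le> \<bar>p gchoose (k + n)\<bar> * (1/2) ^ k" for k
    using assms by (auto simp: abs_mult power_abs intro!: mult_left_mono power_mono)
  have "(1 + x) powr p - (\<Sum>k<n. (p gchoose k) * x ^ k) = (\<Sum>k. (p gchoose (k + n)) * x ^ (k + n))"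
    using s suminf_split_initial_segment[of "\<lambda>k. (p gchoose k) * x ^ k" n] by (auto simp: sums_iff)
  also have "\<dots> = (\<Sum>k. x ^ n * ((p gchoose (k + n)) * x ^ k))"
    by (simp add: power_add mult_ac)
  also have "\<dots> = x ^ n * (\<Sum>k. (p gchoose (k + n)) * x ^ k)"
    using le by (intro suminf_mult summable_comparison_test'[OF major, of 0]) auto
  finally have "\<bar>(1 + x) powr p - (\<Sum>k<n. (p gchoose k) * x ^ k)\<bar> =
      \<bar>x\<bar> ^ n * norm (\<Sum>k. (p gchoose (k + n)) * x ^ k)" by (simp add: abs_mult power_abs)
  also have "\<dots> \<le> \<bar>x\<bar> ^ n * (\<Sum>k. \<bar>p gchoose (k + n)\<bar> * (1/2) ^ k)"
    using le major by (intro mult_left_mono norm_suminf_le) auto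
  finally show ?thesis .
qed

text \<open>The sum subtracted in the kernel is \<open>v\<^bsup>p\<^esup>\<close> times the truncated binomial series of
  \<open>(1 + t / v)\<^bsup>p\<^esup>\<close>, with \<open>v\<close> in the role of \<open>-u\<close>. Hence cancellation gains the factor \<open>v\<^bsup>-n\<^esup>\<close>.\<close>

lemma powr_taylor_remainder_bound:
  fixes t p :: real
  obtains C where "\<And>v. \<lbrakk>0 < v; 2 * \<bar>t\<bar> \<le> v\<rbrakk> \<Longrightarrow>
    \<bar>(t + v) powr p - (\<Sum>k<n. t ^ k / fact k * v powr (p - real k) * (\<Prod>j<k. p - real j))\<bar> \<le> C * v powr (p - real n)"
proof (rule that)
  let ?S = "\<Sum>k. \<bar>p gchoose (k + n)\<bar> * (1/2) ^ k"
  fix v assume v: "0 < v" "2 * \<bar>t\<bar> \<le> v"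
  have x: "\<bar>t / v\<bar> \<le> 1/2" using v by (simp add: field_simps)
  have tv: "t + v = v * (1 + t / v)" "0 \<le> 1 + t / v"
    using v x by (auto simp: field_simps abs_le_iff)
  have "(t + v) powr p - (\<Sum>k<n. t ^ k / fact k * v powr (p - real k) * (\<Prod>j<k. p - real j)) =
      v powr p * ((1 + t / v) powr p - (\<Sum>k<n. (p gchoose k) * (t / v) ^ k))"
    using v tv
    by (auto simp: powr_mult powr_diff powr_realpow right_diff_distrib sum_distrib_left gbinomial_prod_rev
        atLeast0LessThan power_divide intro!: sum.cong)
  then have "\<bar>(t + v) powr p - (\<Sum>k<n. t ^ k / fact k * v powr (p - real k) * (\<Prod>j<k. p - real j))\<bar> =
      v powr p * \<bar>(1 + t / v) powr p - (\<Sum>k<n. (p gchoose k) * (t / v) ^ k)\<bar>"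
    by (simp add: abs_mult)
  also have "\<dots> \<le> v powr p * (\<bar>t / v\<bar> ^ n * ?S)"
    by (intro mult_left_mono binomial_remainder_bound x) auto
  also have "\<dots> = \<bar>t\<bar> ^ n * ?S * v powr (p - real n)"
    using v by (simp add: powr_diff powr_realpow abs_divide power_divide)
  finally show "\<bar>(t + v) powr p - (\<Sum>k<n. t ^ k / fact k * v powr (p - real k) * (\<Prod>j<k. p - real j))\<bar> \<le>
    \<bar>t\<bar> ^ n * ?S * v powr (p - real n)" .
qed

text \<open>The line is cut at distance \<open>R = 2 \<bar>t\<bar> + 1\<close> from the origin. Inside, each summand is
  \<open>\<alpha>\<close>-integrable by itself. To the left, the Taylor bound controls the whole difference. To the
  right the kernel vanishes.\<close>

lemma mfsm_kernel_in_L_alpha: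
  assumes \<alpha>: "1 < \<alpha>" and H: "real n - 1 < H t" "H t < real n" and n: "1 \<le> n"
  shows "mfsm_kernel n \<alpha> H t \<in> L_alpha \<alpha>"
proof -
  define p where "p = H t - 1 / \<alpha>"
  define R where "R = 2 * \<bar>t\<bar> + 1"
  define g where "g u = pos_power (t - u) p -
         (\<Sum>k<n. t ^ k / fact k * pos_power (- u) (p - real k) * (\<Prod>j<k. p - real j))" for u
  have kernel: "mfsm_kernel n \<alpha> H t = (\<lambda>u. 1 / Gamma (p + 1) * g u)"
    by (simp add: mfsm_kernel_def g_def p_def Let_def fun_eq_iff)
  have [measurable]: "g \<in> borel_measurable borel" unfolding g_def by measurable
  have p\<alpha>: "p * \<alpha> = H t * \<alpha> - 1" using \<alpha> by (simp add: p_def field_simps)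
  have near: "-1 < (p - real k) * \<alpha>" if "k < n" for k
  proof -
    have "0 < (H t - real k) * \<alpha>" using \<alpha> H that by (intro mult_pos_pos) auto
    then show ?thesis by (simp add: left_diff_distrib p\<alpha>)
  qed
  have far: "(p - real n) * \<alpha> < -1"
  proof -
    have "(H t - real n) * \<alpha> < 0" using \<alpha> H by (intro mult_neg_pos) auto
    then show ?thesis by (simp add: left_diff_distrib p\<alpha>)
  qed
  have local: "(\<lambda>u. indicator {-R..R} u * g u) \<in> L_alpha \<alpha>"
  proof -
    have "(\<lambda>u. indicator {-R..R} u * pos_power (t - u) (p - real 0) +
        (\<Sum>k<n. - (t ^ k / fact k * (\<Prod>j<k. p - real j)) * (indicator {-R..R} u * pos_power (0 - u) (p - real k)))) \<in> L_alpha \<alpha>"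
      using n \<alpha> by (intro L_alpha_add L_alpha_sum L_alpha_cmult truncated_pos_power_in_L_alpha near) auto
    also have "(\<lambda>u. indicator {-R..R} u * pos_power (t - u) (p - real 0) +
        (\<Sum>k<n. - (t ^ k / fact k * (\<Prod>j<k. p - real j)) * (indicator {-R..R} u * pos_power (0 - u) (p - real k)))) =
        (\<lambda>u. indicator {-R..R} u * g u)"
      by (simp add: g_def fun_eq_iff right_diff_distrib sum_distrib_left sum_negf mult_ac)
    finally show ?thesis .
  qed
  have tail: "(\<lambda>u. indicator (- {-R..R}) u * g u) \<in> L_alpha \<alpha>"
  proof -
    obtain C where C: "\<And>v. \<lbrakk>0 < v; 2 * \<bar>t\<bar> \<le> v\<rbrakk> \<Longrightarrow>
      \<bar>(t + v) powr p - (\<Sum>k<n. t ^ k / fact k * v powr (p - real k) * (\<Prod>j<k. p - real j))\<bar> \<le> C * v powr (p - real n)"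
      by (rule powr_taylor_remainder_bound) blast
    let ?h = "\<lambda>v. \<bar>C\<bar> powr \<alpha> * (indicator {R..} v * v powr ((p - real n) * \<alpha>))"
    show ?thesis
    proof (rule L_alphaI_dominated)
      show "integrable lborel (\<lambda>u. ?h (0 + (-1) * u))"
        by (intro lborel_integrable_real_affine integrable_mult_right integrable_powr_at_infinity far)
          (auto simp: R_def)
      show "AE u in lborel. \<bar>indicator (- {-R..R}) u * g u\<bar> powr \<alpha> \<le> ?h (0 + (-1) * u)"
      proof (rule AE_I2)
        fix u :: real
        consider "u < -R" | "-R \<le> u" "u \<le> R" | "R < u" by linarith
        then show "\<bar>indicator (- {-R..R}) u * g u\<bar> powr \<alpha> \<le> ?h (0 + (-1) * u)"
        proof cases
          case 1
          then have v: "0 < - u" "2 * \<bar>t\<bar> \<le> - u" "0 < t - u" by (auto simp: R_def)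
          have "\<bar>g u\<bar> \<le> C * (- u) powr (p - real n)"
            using C[OF v(1,2)] v by (simp add: g_def pos_power_def)
          also have "\<dots> \<le> \<bar>C\<bar> * (- u) powr (p - real n)" by (intro mult_right_mono) auto
          finally have "\<bar>g u\<bar> powr \<alpha> \<le> (\<bar>C\<bar> * (- u) powr (p - real n)) powr \<alpha>"
            using \<alpha> by (intro powr_mono2) auto
          also have "\<dots> = \<bar>C\<bar> powr \<alpha> * (- u) powr ((p - real n) * \<alpha>)"
            by (simp add: powr_mult powr_powr)
          finally show ?thesis using 1 by (auto simp: indicator_def)
        next
          case 3
          then have "t - u < 0" "- u < 0" by (auto simp: R_def)
          then have "g u = 0" by (simp add: g_def pos_power_def)
          then show ?thesis by simp
        qed simp
      qed
    qed measurable
  qed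
  have "(\<lambda>u. 1 / Gamma (p + 1) * (indicator {-R..R} u * g u + indicator (- {-R..R}) u * g u)) \<in> L_alpha \<alpha>"
    using \<alpha> by (intro L_alpha_cmult L_alpha_add local tail) auto
  also have "(\<lambda>u. 1 / Gamma (p + 1) * (indicator {-R..R} u * g u + indicator (- {-R..R}) u * g u)) =
     mfsm_kernel n \<alpha> H t"
    unfolding kernel by (auto simp: fun_eq_iff indicator_def)
  finally show ?thesis .
qed

section \<open>Finite differences of the kernel\<close>

text \<open>Pascal's rule: a difference of order \<open>n + 1\<close> is a difference of order \<open>n\<close> of first
  differences. This is the induction step for the vanishing of differences of polynomials.\<close>

lemma alternating_binomial_sum_Suc:
  fixes g :: "real \<Rightarrow> real"
  shows "(\<Sum>k\<le>Suc n. (- 1) ^ (Suc n - k) * real (Suc n choose k) * g (t + real k * h)) =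
    (\<Sum>k\<le>n. (- 1) ^ (n - k) * real (n choose k) * (g (t + real k * h + h) - g (t + real k * h)))"
proof -
  let ?G = "\<lambda>k. g (t + real k * h)"
  have step: "(\<Sum>k\<le>Suc n. (- 1) ^ (Suc n - k) * real (Suc n choose k) * ?G k) =
      (- 1) ^ Suc n * ?G 0 + (\<Sum>k\<le>n. (- 1) ^ (n - k) * real (n choose k) * ?G (Suc k))
      + (\<Sum>k\<le>n. (- 1) ^ (n - k) * real (n choose Suc k) * ?G (Suc k))"
    by (subst sum.atMost_Suc_shift) (simp add: algebra_simps sum.distrib)
  have "(\<Sum>k\<le>n. (- 1) ^ (n - k) * real (n choose Suc k) * ?G (Suc k)) + (- 1) ^ Suc n * ?G 0 =
      (\<Sum>k\<le>Suc n. (- 1) ^ (Suc n - k) * real (n choose k) * ?G k)"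
    by (subst sum.atMost_Suc_shift) simp
  also have "\<dots> = - (\<Sum>k\<le>n. (- 1) ^ (n - k) * real (n choose k) * ?G k)"
    by (simp add: sum_negf[symmetric] Suc_diff_le)
  finally show ?thesis
    using step by (simp add: algebra_simps sum_subtractf)
qed

text \<open>A first difference of \<open>s\<^sup>j\<close> is a polynomial of degree below \<open>j\<close>, so \<open>n > j\<close> differences leave
  nothing.\<close>

lemma alternating_binomial_sum_power:
  fixes t h :: real
  assumes "j < n"
  shows "(\<Sum>k\<le>n. (- 1) ^ (n - k) * real (n choose k) * (t + real k * h) ^ j) = 0"
  using assms
proof (induction n arbitrary: j)
  case (Suc n)
  have diff: "(s + h) ^ j - s ^ j = (\<Sum>i<j. real (j choose i) * h ^ (j - i) * s ^ i)" for s :: real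
    by (simp add: binomial_ring lessThan_Suc_atMost[symmetric] mult_ac)
  have "(\<Sum>k\<le>Suc n. (- 1) ^ (Suc n - k) * real (Suc n choose k) * (t + real k * h) ^ j) =
      (\<Sum>k\<le>n. (- 1) ^ (n - k) * real (n choose k) * (\<Sum>i<j. real (j choose i) * h ^ (j - i) * (t + real k * h) ^ i))"
    using alternating_binomial_sum_Suc[of n "\<lambda>s. s ^ j" t h] by (simp only: diff)
  also have "\<dots> = (\<Sum>i<j. real (j choose i) * h ^ (j - i) *
      (\<Sum>k\<le>n. (- 1) ^ (n - k) * real (n choose k) * (t + real k * h) ^ i))"
    unfolding sum_distrib_left by (subst sum.swap) (simp add: mult_ac)
  also have "\<dots> = 0" using Suc by (intro sum.neutral) auto
  finally show ?case .
qed simp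

text \<open>For fixed \<open>u\<close> the sum subtracted in the kernel is a polynomial in \<open>t\<close> of degree below \<open>n\<close>, with
  the same coefficients at all grid points when \<open>H\<close> has the same value there. The difference
  of order \<open>n\<close> removes it, and what is left depends on \<open>t\<close> through \<open>u - t\<close> only.\<close>

lemma nth_increment_mfsm_kernel:
  assumes "\<And>k. k \<le> n \<Longrightarrow> H (t + real k * h) = c"
  shows "(\<Sum>k\<le>n. (- 1) ^ (n - k) * real (n choose k) * mfsm_kernel n \<alpha> H (t + real k * h) u) =
    1 / Gamma (c - 1 / \<alpha> + 1) *
      (\<Sum>k\<le>n. (- 1) ^ (n - k) * real (n choose k) * pos_power (real k * h - (u - t)) (c - 1 / \<alpha>))"
proof -
  define p where "p = c - 1 / \<alpha>"
  let ?b = "\<lambda>k. (- 1) ^ (n - k) * real (n choose k)"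
  have "(\<Sum>k\<le>n. ?b k * (\<Sum>j<n. (t + real k * h) ^ j / fact j * pos_power (- u) (p - real j) * (\<Prod>i<j. p - real i)))
      = (\<Sum>j<n. pos_power (- u) (p - real j) * (\<Prod>i<j. p - real i) / fact j * (\<Sum>k\<le>n. ?b k * (t + real k * h) ^ j))"
    unfolding sum_distrib_left by (subst sum.swap) (simp add: mult_ac)
  also have "\<dots> = 0" by (intro sum.neutral) (simp add: alternating_binomial_sum_power)
  finally have poly: "(\<Sum>k\<le>n. ?b k * (\<Sum>j<n. (t + real k * h) ^ j / fact j * pos_power (- u) (p - real j) * (\<Prod>i<j. p - real i))) = 0" .
  have "(\<Sum>k\<le>n. ?b k * mfsm_kernel n \<alpha> H (t + real k * h) u) =
     (\<Sum>k\<le>n. 1 / Gamma (p + 1) * (?b k * pos_power (real k * h - (u - t)) p -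
       ?b k * (\<Sum>j<n. (t + real k * h) ^ j / fact j * pos_power (- u) (p - real j) * (\<Prod>i<j. p - real i))))"
    using assms by (intro sum.cong) (auto simp: mfsm_kernel_def Let_def p_def algebra_simps)
  also have "\<dots> = 1 / Gamma (p + 1) * (\<Sum>k\<le>n. ?b k * pos_power (real k * h - (u - t)) p)"
    unfolding sum_distrib_left[symmetric] sum_subtractf poly by simp
  finally show ?thesis by (simp add: p_def)
qed


section \<open>Integrals of simple functions\<close>

lemma simple_finite_range:
  fixes \<phi> :: "real \<Rightarrow> real"
  assumes "Bochner_Integration.simple_bochner_integrable lborel \<phi>"
  shows "finite (range \<phi>)"
  using assms by (auto elim!: Bochner_Integration.simple_bochner_integrable.cases dest: simple_functionD(1))

lemma simple_measurable:
  fixes \<phi> :: "real \<Rightarrow> real"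
  assumes "Bochner_Integration.simple_bochner_integrable lborel \<phi>"
  shows "\<phi> \<in> borel_measurable borel"
  using assms by (auto elim!: Bochner_Integration.simple_bochner_integrable.cases dest: borel_measurable_simple_function)

lemma simple_finite_support:
  fixes \<phi> :: "real \<Rightarrow> real"
  assumes "Bochner_Integration.simple_bochner_integrable lborel \<phi>"
  shows "{u. \<phi> u \<noteq> 0} \<in> finite_borel_sets"
  using assms simple_measurable[OF assms]
  by (auto elim!: Bochner_Integration.simple_bochner_integrable.cases
      simp: finite_borel_sets_def less_top[symmetric])

lemma finite_borel_sets_mono:
  assumes "A \<in> finite_borel_sets" "B \<in> sets borel" "B \<subseteq> A"
  shows "B \<in> finite_borel_sets"
  using assms emeasure_mono[of B A lborel] by (auto simp: finite_borel_sets_def)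

lemma simple_level_set:
  fixes \<phi> :: "real \<Rightarrow> real"
  assumes \<phi>: "Bochner_Integration.simple_bochner_integrable lborel \<phi>" and "y \<noteq> 0"
  shows "\<phi> -` {y} \<in> finite_borel_sets"
  using measurable_sets[OF simple_measurable[OF \<phi>], of "{y}"] assms(2)
  by (intro finite_borel_sets_mono[OF simple_finite_support[OF \<phi>]]) auto

lemma simple_lincomb:
  fixes \<phi> \<psi> :: "real \<Rightarrow> real"
  assumes \<phi>: "Bochner_Integration.simple_bochner_integrable lborel \<phi>"
    and \<psi>: "Bochner_Integration.simple_bochner_integrable lborel \<psi>"
  shows "Bochner_Integration.simple_bochner_integrable lborel (\<lambda>u. a * \<phi> u + b * \<psi> u)"
  by (rule simple_bochner_integrable_compose2[OF _ \<phi> \<psi>, of "\<lambda>x y. a * x + b * y"]) simp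

lemma simple_powr_eq:
  fixes \<phi> :: "real \<Rightarrow> real"
  assumes \<phi>: "Bochner_Integration.simple_bochner_integrable lborel \<phi>"
  shows "\<bar>\<phi> u\<bar> powr \<alpha> = (\<Sum>y\<in>range \<phi> - {0}. \<bar>y\<bar> powr \<alpha> * indicator (\<phi> -` {y}) u)"
proof (cases "\<phi> u = 0")
  case False
  then have "(\<Sum>y\<in>range \<phi> - {0}. \<bar>y\<bar> powr \<alpha> * indicator (\<phi> -` {y}) u) =
      (\<Sum>y\<in>range \<phi> - {0}. if y = \<phi> u then \<bar>\<phi> u\<bar> powr \<alpha> else 0)"
    by (intro sum.cong) (auto simp: indicator_def)
  also have "\<dots> = \<bar>\<phi> u\<bar> powr \<alpha>"
    using False simple_finite_range[OF \<phi>] by (subst sum.delta) auto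
  finally show ?thesis by simp
next
  case True
  then have "(\<Sum>y\<in>range \<phi> - {0}. \<bar>y\<bar> powr \<alpha> * indicator (\<phi> -` {y}) u) = 0"
    by (intro sum.neutral) (auto simp: indicator_def)
  with True show ?thesis by simp
qed

lemma simple_has_modular:
  fixes \<phi> :: "real \<Rightarrow> real"
  assumes \<phi>: "Bochner_Integration.simple_bochner_integrable lborel \<phi>"
  shows "has_bochner_integral lborel (\<lambda>u. \<bar>\<phi> u\<bar> powr \<alpha>)
    (\<Sum>y\<in>range \<phi> - {0}. \<bar>y\<bar> powr \<alpha> * measure lborel (\<phi> -` {y}))"
  unfolding simple_powr_eq[OF \<phi>]
proof (intro has_bochner_integral_sum has_bochner_integral_mult_right)
  fix y assume "y \<in> range \<phi> - {0}"
  then have "\<phi> -` {y} \<in> finite_borel_sets" using simple_level_set[OF \<phi>] by auto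
  then show "has_bochner_integral lborel (indicator (\<phi> -` {y})) (measure lborel (\<phi> -` {y}))"
    by (intro has_bochner_integral_real_indicator) (auto simp: finite_borel_sets_def)
qed

lemma simple_modular:
  fixes \<phi> :: "real \<Rightarrow> real"
  assumes \<phi>: "Bochner_Integration.simple_bochner_integrable lborel \<phi>"
  shows "L_alpha_modular \<alpha> \<phi> = (\<Sum>y\<in>range \<phi> - {0}. \<bar>y\<bar> powr \<alpha> * measure lborel (\<phi> -` {y}))"
  using simple_has_modular[OF \<phi>] unfolding L_alpha_modular_def by (rule has_bochner_integral_integral_eq)

lemma simple_in_L_alpha:
  fixes \<phi> :: "real \<Rightarrow> real"
  assumes \<phi>: "Bochner_Integration.simple_bochner_integrable lborel \<phi>"
  shows "\<phi> \<in> L_alpha \<alpha>"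
  using simple_has_modular[OF \<phi>] simple_measurable[OF \<phi>] by (auto simp: L_alpha_def has_bochner_integral_iff)

context SaS_random_measure
begin

text \<open>A constant sequence is summable only if it vanishes.\<close>

lemma M_empty: "AE \<omega> in P. M {} \<omega> = 0"
proof -
  have "{} \<in> finite_borel_sets" by (simp add: finite_borel_sets_def)
  then have "AE \<omega> in P. (\<lambda>_::nat. M {} \<omega>) sums M {} \<omega>"
    using countably_additive_M[of "\<lambda>_. {}"] by (auto simp: disjoint_family_on_def)
  then show ?thesis
  proof eventually_elim
    case (elim \<omega>)
    then have "(\<lambda>_::nat. M {} \<omega>) \<longlonglongrightarrow> 0" by (intro summable_LIMSEQ_zero sums_summable)
    then show ?case by (simp add: LIMSEQ_const_iff)
  qed
qed

lemma M_Un: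
  assumes A: "A \<in> finite_borel_sets" and B: "B \<in> finite_borel_sets" and "A \<inter> B = {}"
  shows "A \<union> B \<in> finite_borel_sets" "AE \<omega> in P. M (A \<union> B) \<omega> = M A \<omega> + M B \<omega>"
proof -
  show AB: "A \<union> B \<in> finite_borel_sets"
  proof -
    have "emeasure lborel (A \<union> B) \<le> emeasure lborel A + emeasure lborel B"
      using A B by (intro emeasure_subadditive) (simp_all add: finite_borel_sets_def)
    also have "\<dots> < \<infinity>" using A B by (simp add: finite_borel_sets_def)
    finally show ?thesis using A B sets.Un[of A borel B] by (simp add: finite_borel_sets_def)
  qed
  \<comment> \<open>the sequence \<open>A, B, {}, {}, ...\<close>\<close>
  have "AE \<omega> in P. (\<lambda>i. M (binaryset A B i) \<omega>) sums M (\<Union>i. binaryset A B i) \<omega>"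
  proof (rule countably_additive_M)
    show "binaryset A B i \<in> finite_borel_sets" for i
      using A B finite_borel_sets_mono[OF A, of "{}"] by (simp add: binaryset_def)
    show "disjoint_family (binaryset A B)"
      using assms(3) by (auto simp: disjoint_family_on_def binaryset_def)
    show "(\<Union>i. binaryset A B i) \<in> finite_borel_sets" using AB by (simp add: UN_binaryset_eq)
  qed
  with M_empty show "AE \<omega> in P. M (A \<union> B) \<omega> = M A \<omega> + M B \<omega>"
  proof eventually_elim
    case (elim \<omega>)
    have "(\<lambda>i. M (binaryset A B i) \<omega>) sums (M A \<omega> + M B \<omega>)"
      using elim(1) by (rule binaryset_sums[where f="\<lambda>C. M C \<omega>"])
    with elim(2) show ?case by (simp add: UN_binaryset_eq sums_unique2)
  qed
qed

lemma M_finite_UN: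
  assumes "finite F" and "\<And>i. i \<in> F \<Longrightarrow> A i \<in> finite_borel_sets" and "disjoint_family_on A F"
  shows "(\<Union>i\<in>F. A i) \<in> finite_borel_sets \<and> (AE \<omega> in P. M (\<Union>i\<in>F. A i) \<omega> = (\<Sum>i\<in>F. M (A i) \<omega>))"
  using assms
proof (induction F)
  case empty
  then show ?case using M_empty by (simp add: finite_borel_sets_def)
next
  case (insert i F)
  have dis: "disjoint_family_on A F" "A i \<inter> (\<Union>i\<in>F. A i) = {}"
    using insert.prems(2) insert.hyps by (auto simp: disjoint_family_on_def)
  have IH: "(\<Union>i\<in>F. A i) \<in> finite_borel_sets" "AE \<omega> in P. M (\<Union>i\<in>F. A i) \<omega> = (\<Sum>i\<in>F. M (A i) \<omega>)"
    using insert.IH insert.prems(1) dis(1) by auto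
  note U = M_Un[OF insert.prems(1)[of i] IH(1) dis(2)]
  from IH(2) U(2) have "AE \<omega> in P. M (A i \<union> (\<Union>i\<in>F. A i)) \<omega> = M (A i) \<omega> + (\<Sum>i\<in>F. M (A i) \<omega>)"
    by auto
  then show ?case using U(1) insert.hyps by simp
qed

text \<open>By additivity of \<open>M\<close>, any finite partition into sets on which a simple function is constant
  computes its integral almost surely. The function \<open>g\<close> labels the cells, and \<open>z0\<close> is the label of the single cell that may
  have infinite measure, where the integrand \<open>q \<circ> g\<close> vanishes. With \<open>g u = (\<phi> u, \<psi> u)\<close> this
  provides a common refinement for two simple functions.\<close>

lemma simple_stable_integral_partition:
  fixes g :: "real \<Rightarrow> 'b" and q :: "'b \<Rightarrow> real"
  assumes fin: "finite (range g)" and level: "\<And>z. z \<noteq> z0 \<Longrightarrow> g -` {z} \<in> finite_borel_sets"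
    and q0: "q z0 = 0"
  shows "AE \<omega> in P. simple_stable_integral M (\<lambda>u. q (g u)) \<omega> = (\<Sum>z\<in>range g - {z0}. q z * M (g -` {z}) \<omega>)"
proof -
  define Z where "Z = {z \<in> range g. q z \<noteq> 0}"
  have finZ: "finite Z" using fin by (simp add: Z_def)
  have range: "range (\<lambda>u. q (g u)) - {0} = q ` Z" by (auto simp: Z_def)
  have "AE \<omega> in P. M ((\<lambda>u. q (g u)) -` {y}) \<omega> = (\<Sum>z\<in>{z\<in>Z. q z = y}. M (g -` {z}) \<omega>)" if "y \<in> q ` Z" for y
  proof -
    have "(\<lambda>u. q (g u)) -` {y} = (\<Union>z\<in>{z\<in>Z. q z = y}. g -` {z})"
      using that by (auto simp: Z_def)
    moreover have "z \<noteq> z0" if "z \<in> Z" for z using that q0 by (auto simp: Z_def)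
    ultimately show ?thesis
      using M_finite_UN[of "{z\<in>Z. q z = y}" "\<lambda>z. g -` {z}"] finZ level
      by (auto simp: disjoint_family_on_def)
  qed
  then have "AE \<omega> in P. \<forall>y\<in>q ` Z. M ((\<lambda>u. q (g u)) -` {y}) \<omega> = (\<Sum>z\<in>{z\<in>Z. q z = y}. M (g -` {z}) \<omega>)"
    using finZ by (intro AE_finite_allI) auto
  then show ?thesis
  proof eventually_elim
    case (elim \<omega>)
    have "simple_stable_integral M (\<lambda>u. q (g u)) \<omega> = (\<Sum>y\<in>q ` Z. y * M ((\<lambda>u. q (g u)) -` {y}) \<omega>)"
      unfolding simple_stable_integral_def range ..
    also have "\<dots> = (\<Sum>y\<in>q ` Z. \<Sum>z\<in>{z\<in>Z. q z = y}. q z * M (g -` {z}) \<omega>)"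
      using elim by (intro sum.cong) (auto simp: sum_distrib_left)
    also have "\<dots> = (\<Sum>z\<in>Z. q z * M (g -` {z}) \<omega>)"
      using finZ by (intro sum.group) auto
    also have "\<dots> = (\<Sum>z\<in>range g - {z0}. q z * M (g -` {z}) \<omega>)"
      using fin q0 by (intro sum.mono_neutral_left) (auto simp: Z_def)
    finally show ?case .
  qed
qed

lemma simple_stable_integral_lincomb:
  assumes \<phi>: "Bochner_Integration.simple_bochner_integrable lborel \<phi>"
    and \<psi>: "Bochner_Integration.simple_bochner_integrable lborel \<psi>"
  shows "AE \<omega> in P. simple_stable_integral M (\<lambda>u. a * \<phi> u + b * \<psi> u) \<omega> =
    a * simple_stable_integral M \<phi> \<omega> + b * simple_stable_integral M \<psi> \<omega>"
proof -
  let ?g = "\<lambda>u. (\<phi> u, \<psi> u)"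
  have fin: "finite (range ?g)"
    by (rule finite_subset[of _ "range \<phi> \<times> range \<psi>"]) (use simple_finite_range[OF \<phi>] simple_finite_range[OF \<psi>] in auto)
  have level: "?g -` {z} \<in> finite_borel_sets" if "z \<noteq> (0, 0)" for z
  proof -
    have eq: "?g -` {z} = \<phi> -` {fst z} \<inter> \<psi> -` {snd z}" by auto
    have "\<phi> -` {fst z} \<in> sets borel" "\<psi> -` {snd z} \<in> sets borel"
      using measurable_sets[OF simple_measurable[OF \<phi>], of "{fst z}"]
        measurable_sets[OF simple_measurable[OF \<psi>], of "{snd z}"] by auto
    then have set: "?g -` {z} \<in> sets borel" unfolding eq by auto
    show ?thesis
    proof (cases "fst z = 0")
      case True
      with that have nz: "snd z \<noteq> 0" by (cases z) auto
      show ?thesis by (rule finite_borel_sets_mono[OF simple_level_set[OF \<psi> nz] set]) auto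
    next
      case False
      show ?thesis by (rule finite_borel_sets_mono[OF simple_level_set[OF \<phi> False] set]) auto
    qed
  qed
  note part = simple_stable_integral_partition[OF fin level]
  have "AE \<omega> in P. simple_stable_integral M \<phi> \<omega> = (\<Sum>z\<in>range ?g - {(0, 0)}. fst z * M (?g -` {z}) \<omega>)"
    using part[where q=fst] by simp
  moreover have "AE \<omega> in P. simple_stable_integral M \<psi> \<omega> = (\<Sum>z\<in>range ?g - {(0, 0)}. snd z * M (?g -` {z}) \<omega>)"
    using part[where q=snd] by simp
  moreover have "AE \<omega> in P. simple_stable_integral M (\<lambda>u. a * \<phi> u + b * \<psi> u) \<omega> =
      (\<Sum>z\<in>range ?g - {(0, 0)}. (a * fst z + b * snd z) * M (?g -` {z}) \<omega>)"
    using part[where q="\<lambda>z. a * fst z + b * snd z"] by simp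
  ultimately show ?thesis
    by eventually_elim (simp only: distrib_right sum.distrib sum_distrib_left mult.assoc)
qed

lemma simple_stable_integral_measurable:
  assumes \<phi>: "Bochner_Integration.simple_bochner_integrable lborel \<phi>"
  shows "simple_stable_integral M \<phi> \<in> borel_measurable P"
proof -
  have "(\<lambda>\<omega>. \<Sum>y\<in>range \<phi> - {0}. y * M (\<phi> -` {y}) \<omega>) \<in> borel_measurable P"
    using random_variable_M simple_level_set[OF \<phi>]
    by (intro borel_measurable_sum borel_measurable_times) auto
  then show ?thesis by (simp add: simple_stable_integral_def[abs_def])
qed

text \<open>The summands are independent, because the level sets are disjoint. Independent scattering is
  a property of sequences of sets, which is why the nonzero values of \<open>\<phi>\<close> are enumerated.\<close>

lemma char_simple_stable_integral:
  assumes \<phi>: "Bochner_Integration.simple_bochner_integrable lborel \<phi>"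
  shows "(CLINT \<omega>|P. iexp (\<theta> * simple_stable_integral M \<phi> \<omega>)) =
    complex_of_real (exp (- (\<bar>\<theta>\<bar> powr \<alpha> * L_alpha_modular \<alpha> \<phi>)))"
proof -
  let ?R = "range \<phi> - {0}"
  have "finite ?R" using simple_finite_range[OF \<phi>] by simp
  then obtain h where h: "bij_betw h {..<card ?R} ?R"
    using ex_bij_betw_nat_finite[unfolded atLeast0LessThan] by blast
  let ?I = "{..<card ?R}"
  let ?X = "\<lambda>i. M (\<phi> -` {h i})"
  have hR: "h i \<in> ?R" if "i \<in> ?I" for i using h that by (auto simp: bij_betw_def)
  then have level: "\<phi> -` {h i} \<in> finite_borel_sets" if "i \<in> ?I" for i
    using simple_level_set[OF \<phi>] that by auto
  have dis: "disjoint_family_on (\<lambda>i. \<phi> -` {h i}) ?I"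
    using h unfolding disjoint_family_on_def bij_betw_def inj_on_def by fastforce
  have indep: "indep_vars (\<lambda>_. borel) ?X ?I"
    by (rule independently_scattered[OF level dis])
  then have indep: "indep_vars (\<lambda>_. borel) (\<lambda>i \<omega>. h i * ?X i \<omega>) ?I"
    by (rule indep_vars_compose2[where Y="\<lambda>i x. h i * x"]) simp
  have sum: "simple_stable_integral M \<phi> \<omega> = (\<Sum>i\<in>?I. h i * ?X i \<omega>)" for \<omega>
    unfolding simple_stable_integral_def by (rule sum.reindex_bij_betw[OF h, symmetric])
  note [measurable] = simple_stable_integral_measurable[OF \<phi>] random_variable_M[OF level]
  have one: "char (distr P borel (\<lambda>\<omega>. h i * ?X i \<omega>)) \<theta> =
      of_real (exp (- (\<bar>\<theta>\<bar> powr \<alpha> * (\<bar>h i\<bar> powr \<alpha> * measure lborel (\<phi> -` {h i})))))" if i: "i \<in> ?I" for i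
  proof -
    have "char (distr P borel (\<lambda>\<omega>. h i * ?X i \<omega>)) \<theta> = (CLINT \<omega>|P. iexp ((\<theta> * h i) * ?X i \<omega>))"
      unfolding char_def using random_variable_M[OF level[OF i]]
      by (subst integral_distr) (auto simp: mult.assoc)
    then show ?thesis unfolding char_M[OF level[OF i]] by (simp add: abs_mult powr_mult mult.assoc)
  qed
  have "(CLINT \<omega>|P. iexp (\<theta> * simple_stable_integral M \<phi> \<omega>)) = char (distr P borel (simple_stable_integral M \<phi>)) \<theta>"
    unfolding char_def by (subst integral_distr) auto
  also have "\<dots> = char (distr P borel (\<lambda>\<omega>. \<Sum>i\<in>?I. h i * ?X i \<omega>)) \<theta>" by (simp only: sum[abs_def])
  also have "char (distr P borel (\<lambda>\<omega>. \<Sum>i\<in>?I. h i * ?X i \<omega>)) \<theta> =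
      (\<Prod>i\<in>?I. char (distr P borel (\<lambda>\<omega>. h i * ?X i \<omega>)) \<theta>)"
    by (rule char_distr_sum[OF indep])
  also have "\<dots> = (\<Prod>i\<in>?I. of_real (exp (- (\<bar>\<theta>\<bar> powr \<alpha> * (\<bar>h i\<bar> powr \<alpha> * measure lborel (\<phi> -` {h i}))))))"
    by (intro prod.cong refl one)
  also have "\<dots> = of_real (exp (- (\<bar>\<theta>\<bar> powr \<alpha> * (\<Sum>i\<in>?I. \<bar>h i\<bar> powr \<alpha> * measure lborel (\<phi> -` {h i})))))"
    by (simp only: of_real_prod[symmetric] exp_sum[symmetric] finite_lessThan sum_negf sum_distrib_left)
  also have "(\<Sum>i\<in>?I. \<bar>h i\<bar> powr \<alpha> * measure lborel (\<phi> -` {h i})) = L_alpha_modular \<alpha> \<phi>"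
    unfolding simple_modular[OF \<phi>] by (rule sum.reindex_bij_betw[OF h])
  finally show ?thesis .
qed

end


section \<open>The stable integral\<close>

text \<open>Let \<open>N\<close> be standard normal. By Fubini, \<open>E exp (-X\<^sup>2/2)\<close> is the mean of the characteristic
  function of \<open>X\<close> over \<open>N\<close>, which is at least \<open>1 - s E \<bar>N\<bar>\<^sup>\<alpha> \<ge> 1 - 2 s\<close>, because \<open>\<bar>N\<bar>\<^sup>\<alpha> \<le> 1 + N\<^sup>2\<close> for
  \<open>\<alpha> \<le> 2\<close>. On the event \<open>\<epsilon> < \<bar>X\<bar>\<close> the variable \<open>1 - exp (-X\<^sup>2/2)\<close> exceeds
  \<open>1 - exp (-\<epsilon>\<^sup>2/2)\<close>, and Markov's inequality gives the bound.\<close>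

lemma (in prob_space) stable_tail_bound:
  assumes X [measurable]: "X \<in> borel_measurable M"
    and char: "\<And>\<theta>. (CLINT \<omega>|M. iexp (\<theta> * X \<omega>)) = complex_of_real (exp (- (\<bar>\<theta>\<bar> powr \<alpha> * s)))"
    and s: "0 \<le> s" and \<alpha>: "0 < \<alpha>" "\<alpha> \<le> 2" and \<epsilon>: "0 < \<epsilon>"
  shows "prob {\<omega> \<in> space M. \<epsilon> < \<bar>X \<omega>\<bar>} \<le> 2 * s / (1 - exp (- \<epsilon>\<^sup>2 / 2))"
proof -
  let ?N = "std_normal_distribution"
  interpret N: real_distribution ?N by (rule real_dist_normal_dist)
  interpret MN: pair_prob_space M ?N ..
  have int: "integrable (M \<Otimes>\<^sub>M ?N) (\<lambda>(\<omega>, \<theta>). iexp (\<theta> * X \<omega>))"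
    by (rule MN.P.integrable_const_bound[where B=1]) (auto simp: norm_exp_i_times simp flip: of_real_mult)
  have fub: "(CLINT \<theta>|?N. (CLINT \<omega>|M. iexp (\<theta> * X \<omega>))) = (CLINT \<omega>|M. (CLINT \<theta>|?N. iexp (\<theta> * X \<omega>)))"
    using MN.Fubini_integral[OF int] by simp
  have "(CLINT \<theta>|?N. iexp (\<theta> * x)) = of_real (exp (- (x\<^sup>2 / 2)))" for x
    using fun_cong[OF char_std_normal_distribution, of x] by (simp add: char_def mult.commute)
  then have "complex_of_real (LINT \<theta>|?N. exp (- (\<bar>\<theta>\<bar> powr \<alpha> * s))) = of_real (LINT \<omega>|M. exp (- ((X \<omega>)\<^sup>2 / 2)))"
    using fub unfolding char by (simp add: integral_complex_of_real)
  then have gauss: "(LINT \<theta>|?N. exp (- (\<bar>\<theta>\<bar> powr \<alpha> * s))) = (LINT \<omega>|M. exp (- ((X \<omega>)\<^sup>2 / 2)))"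
    by (simp only: of_real_eq_iff)
  have sq: "integrable ?N (\<lambda>\<theta>. \<theta>\<^sup>2)" by (rule integrable_std_normal_distribution_moment)
  have "(LINT \<theta>|?N. 1 - s * (1 + \<theta>\<^sup>2)) \<le> (LINT \<theta>|?N. exp (- (\<bar>\<theta>\<bar> powr \<alpha> * s)))"
  proof (rule integral_mono)
    show "integrable ?N (\<lambda>\<theta>. 1 - s * (1 + \<theta>\<^sup>2))" using sq by auto
    show "integrable ?N (\<lambda>\<theta>. exp (- (\<bar>\<theta>\<bar> powr \<alpha> * s)))"
      using s by (intro N.integrable_const_bound[where B=1]) auto
    show "1 - s * (1 + \<theta>\<^sup>2) \<le> exp (- (\<bar>\<theta>\<bar> powr \<alpha> * s))" for \<theta> :: real
    proof -
      have "\<bar>\<theta>\<bar> powr \<alpha> \<le> 1 + \<theta>\<^sup>2"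
      proof (cases "\<bar>\<theta>\<bar> \<le> 1")
        case True
        then have "\<bar>\<theta>\<bar> powr \<alpha> \<le> 1" using \<alpha> by (intro powr_le1) auto
        then show ?thesis using zero_le_power2[of \<theta>] by linarith
      next
        case False
        then have "\<bar>\<theta>\<bar> powr \<alpha> \<le> \<bar>\<theta>\<bar> powr 2" using \<alpha> by (intro powr_mono) auto
        also have "\<dots> = \<theta>\<^sup>2" using False by (subst powr_numeral) auto
        finally show ?thesis by simp
      qed
      then have "\<bar>\<theta>\<bar> powr \<alpha> * s \<le> s * (1 + \<theta>\<^sup>2)" using s by (simp add: mult.commute mult_left_mono)
      then show ?thesis using exp_ge_add_one_self[of "- (\<bar>\<theta>\<bar> powr \<alpha> * s)"] by linarith
    qed
  qed
  moreover have "(LINT \<theta>|?N. 1 - s * (1 + \<theta>\<^sup>2)) = 1 - 2 * s"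
    using sq std_normal_distribution_even_moments(1)[of 1] N.prob_space
    by (simp add: distrib_left fact_numeral)
  ultimately have low: "1 - 2 * s \<le> (LINT \<omega>|M. exp (- ((X \<omega>)\<^sup>2 / 2)))" using gauss by simp
  let ?A = "{\<omega> \<in> space M. \<epsilon> < \<bar>X \<omega>\<bar>}"
  let ?c = "1 - exp (- \<epsilon>\<^sup>2 / 2)"
  have c: "0 < ?c" using \<epsilon> by simp
  have iexpX: "integrable M (\<lambda>\<omega>. exp (- ((X \<omega>)\<^sup>2 / 2)))"
    by (intro integrable_const_bound[where B=1]) auto
  have iA: "integrable M (indicator ?A :: _ \<Rightarrow> real)"
    by (intro integrable_real_indicator) (auto simp: less_top[symmetric])
  have "(LINT \<omega>|M. ?c * indicator ?A \<omega>) \<le> (LINT \<omega>|M. 1 - exp (- ((X \<omega>)\<^sup>2 / 2)))"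
  proof (rule integral_mono)
    show "?c * indicator ?A \<omega> \<le> 1 - exp (- ((X \<omega>)\<^sup>2 / 2))" for \<omega>
    proof (cases "\<omega> \<in> ?A")
      case True
      then have "\<epsilon>\<^sup>2 \<le> (X \<omega>)\<^sup>2" using \<epsilon> by (simp add: abs_le_square_iff[symmetric])
      then show ?thesis using True by simp
    qed auto
  qed (use iexpX iA in auto)
  then have "?c * prob ?A \<le> 2 * s" using low iexpX by (simp add: prob_space)
  then show ?thesis using c by (simp add: field_simps)
qed

text \<open>Identities between integrals of simple functions hold only almost surely, hence the
  form of the hypothesis on \<open>U\<close>.\<close>

lemma tendsto_in_probability_lincomb:
  assumes "prob_space P"
    and meas: "\<And>k. Z k \<in> borel_measurable P" "Y \<in> borel_measurable P"
      "\<And>k. W k \<in> borel_measurable P" "V \<in> borel_measurable P"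
    and Z: "tendsto_in_probability P Z Y" and W: "tendsto_in_probability P W V"
    and U: "\<And>k. AE \<omega> in P. U k \<omega> = a * Z k \<omega> + b * W k \<omega>"
  shows "tendsto_in_probability P U (\<lambda>\<omega>. a * Y \<omega> + b * V \<omega>)"
  unfolding tendsto_in_probability_def
proof (intro allI impI)
  interpret prob_space P by fact
  note [measurable] = meas
  fix \<epsilon> :: real assume "0 < \<epsilon>"
  define A where "A k = {\<omega> \<in> space P. \<epsilon> / (2 * (\<bar>a\<bar> + 1)) < \<bar>Z k \<omega> - Y \<omega>\<bar>}" for k
  define B where "B k = {\<omega> \<in> space P. \<epsilon> / (2 * (\<bar>b\<bar> + 1)) < \<bar>W k \<omega> - V \<omega>\<bar>}" for k
  have [measurable]: "A k \<in> sets P" "B k \<in> sets P" for k unfolding A_def B_def by measurable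
  have lim: "(\<lambda>k. prob (A k) + prob (B k)) \<longlonglongrightarrow> 0 + 0"
    using Z W \<open>0 < \<epsilon>\<close> unfolding tendsto_in_probability_def A_def B_def by (intro tendsto_add) auto
  have small: "\<bar>c\<bar> * d \<le> \<epsilon> / 2" if "d \<le> \<epsilon> / (2 * (\<bar>c\<bar> + 1))" for c d :: real
  proof -
    have "\<bar>c\<bar> * d \<le> \<bar>c\<bar> * (\<epsilon> / (2 * (\<bar>c\<bar> + 1)))" using that by (intro mult_left_mono) auto
    also have "\<dots> \<le> \<epsilon> / 2" using \<open>0 < \<epsilon>\<close> by (simp add: field_simps)
    finally show ?thesis .
  qed
  have le: "prob {\<omega> \<in> space P. \<epsilon> < \<bar>U k \<omega> - (a * Y \<omega> + b * V \<omega>)\<bar>} \<le> prob (A k) + prob (B k)" for k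
  proof -
    have "prob {\<omega> \<in> space P. \<epsilon> < \<bar>U k \<omega> - (a * Y \<omega> + b * V \<omega>)\<bar>} \<le> prob (A k \<union> B k)"
    proof (rule finite_measure_mono_AE)
      show "AE \<omega> in P. \<omega> \<in> {\<omega> \<in> space P. \<epsilon> < \<bar>U k \<omega> - (a * Y \<omega> + b * V \<omega>)\<bar>} \<longrightarrow> \<omega> \<in> A k \<union> B k"
        using U[of k]
      proof eventually_elim
        case (elim \<omega>)
        show ?case
        proof (rule impI, rule ccontr)
          assume \<omega>: "\<omega> \<in> {\<omega> \<in> space P. \<epsilon> < \<bar>U k \<omega> - (a * Y \<omega> + b * V \<omega>)\<bar>}" and "\<omega> \<notin> A k \<union> B k"
          then have "\<bar>a\<bar> * \<bar>Z k \<omega> - Y \<omega>\<bar> \<le> \<epsilon> / 2" "\<bar>b\<bar> * \<bar>W k \<omega> - V \<omega>\<bar> \<le> \<epsilon> / 2"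
            by (auto intro!: small simp: A_def B_def simp del: le_divide_eq_numeral1 distrib_left_numeral)
          moreover have "U k \<omega> - (a * Y \<omega> + b * V \<omega>) = a * (Z k \<omega> - Y \<omega>) + b * (W k \<omega> - V \<omega>)"
            using elim by (simp add: algebra_simps)
          moreover have "\<bar>a * (Z k \<omega> - Y \<omega>) + b * (W k \<omega> - V \<omega>)\<bar> \<le>
              \<bar>a\<bar> * \<bar>Z k \<omega> - Y \<omega>\<bar> + \<bar>b\<bar> * \<bar>W k \<omega> - V \<omega>\<bar>"
            by (metis abs_mult abs_triangle_ineq)
          ultimately show False using \<omega> by simp
        qed
      qed
    qed measurable
    also have "\<dots> \<le> prob (A k) + prob (B k)" by (rule measure_Un_le) auto
    finally show ?thesis .
  qed
  show "(\<lambda>k. prob {\<omega> \<in> space P. \<epsilon> < \<bar>U k \<omega> - (a * Y \<omega> + b * V \<omega>)\<bar>}) \<longlonglongrightarrow> 0"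
    by (rule tendsto_sandwich[OF _ _ tendsto_const lim[simplified]]) (auto intro!: always_eventually le)
qed

lemma AE_tendsto_imp_tendsto_in_probability:
  assumes "prob_space P"
    and [measurable]: "\<And>k. Z k \<in> borel_measurable P" "Y \<in> borel_measurable P"
    and lim: "AE \<omega> in P. (\<lambda>k. Z k \<omega>) \<longlonglongrightarrow> Y \<omega>"
  shows "tendsto_in_probability P Z Y"
  unfolding tendsto_in_probability_def
proof (intro allI impI)
  interpret prob_space P by fact
  fix \<epsilon> :: real assume \<epsilon>: "0 < \<epsilon>"
  let ?A = "\<lambda>k. {\<omega> \<in> space P. \<epsilon> < \<bar>Z k \<omega> - Y \<omega>\<bar>}"
  have "(\<lambda>k. LINT \<omega>|P. indicator (?A k) \<omega>) \<longlonglongrightarrow> (LINT \<omega>|P. 0 :: real)"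
  proof (rule integral_dominated_convergence[where w="\<lambda>_. 1"])
    show "AE \<omega> in P. (\<lambda>k. indicator (?A k) \<omega> :: real) \<longlonglongrightarrow> 0"
      using lim
    proof eventually_elim
      case (elim \<omega>)
      then have "eventually (\<lambda>k. dist (Z k \<omega>) (Y \<omega>) < \<epsilon>) sequentially" using \<epsilon> by (rule tendstoD)
      then have "eventually (\<lambda>k. indicator (?A k) \<omega> = (0::real)) sequentially"
        by eventually_elim (auto simp: indicator_def dist_real_def)
      then show ?case by (rule tendsto_eventually)
    qed
  qed (auto simp: indicator_def)
  then show "(\<lambda>k. prob (?A k)) \<longlonglongrightarrow> 0" by simp
qed

text \<open>Approximation by simple functions \<open>\<psi> k\<close> with \<open>\<bar>\<psi> k\<bar> \<le> 2 \<bar>f\<bar>\<close>. The domination yields convergence in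
  \<open>L\<^sup>\<alpha>\<close> and, without Minkowski's inequality, convergence of the integrals of \<open>\<bar>\<psi> k\<bar>\<^sup>\<alpha>\<close>.\<close>

lemma L_alpha_simple_approximation:
  assumes \<alpha>: "0 < \<alpha>" and f: "f \<in> L_alpha \<alpha>"
  obtains \<psi> where "\<And>k. Bochner_Integration.simple_bochner_integrable lborel (\<psi> k)"
    and "(\<lambda>k. L_alpha_modular \<alpha> (\<lambda>u. \<psi> k u - f u)) \<longlonglongrightarrow> 0"
    and "(\<lambda>k. L_alpha_modular \<alpha> (\<psi> k)) \<longlonglongrightarrow> L_alpha_modular \<alpha> f"
proof -
  have fm: "f \<in> borel_measurable borel" by (rule L_alpha_measurable[OF f])
  then obtain \<psi> where simple: "\<And>k. simple_function lborel (\<psi> k)"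
    and lim: "\<And>u. (\<lambda>k. \<psi> k u) \<longlonglongrightarrow> f u" and bd: "\<And>k u. \<bar>\<psi> k u\<bar> \<le> 2 * \<bar>f u\<bar>"
    using borel_measurable_implies_sequence_metric[of f lborel 0] by (auto simp: dist_real_def)
  have m: "\<psi> k \<in> borel_measurable borel" for k
    using borel_measurable_simple_function[OF simple] by simp
  have bdp: "\<bar>\<psi> k u\<bar> powr \<alpha> \<le> 2 powr \<alpha> * \<bar>f u\<bar> powr \<alpha>" for k u
    using bd[of k u] \<alpha> powr_mono2[of \<alpha> "\<bar>\<psi> k u\<bar>" "2 * \<bar>f u\<bar>"] by (simp add: powr_mult)
  have major: "integrable lborel (\<lambda>u. 2 powr \<alpha> * \<bar>f u\<bar> powr \<alpha>)"
    using L_alpha_integrable[OF f] by simp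
  have L: "\<psi> k \<in> L_alpha \<alpha>" for k
    by (rule L_alphaI_dominated[OF m major]) (auto intro: bdp)
  show ?thesis
  proof (rule that)
    fix k
    show "Bochner_Integration.simple_bochner_integrable lborel (\<psi> k)"
    proof (rule Bochner_Integration.simple_bochner_integrable.intros[OF simple])
      have fin: "finite (range (\<psi> k))" using simple_functionD(1)[OF simple[of k]] by simp
      have "emeasure lborel {u. \<psi> k u \<noteq> 0} \<le> (\<Sum>y\<in>range (\<psi> k) - {0}. emeasure lborel (\<psi> k -` {y}))"
      proof -
        have level: "\<psi> k -` {y} \<in> sets lborel" for y
          using measurable_sets[OF m, of "{y}" k] by simp
        have union: "{u. \<psi> k u \<noteq> 0} = (\<Union>y\<in>range (\<psi> k) - {0}. \<psi> k -` {y})" by auto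
        show ?thesis unfolding union
          by (rule emeasure_subadditive_finite) (use fin level in auto)
      qed
      also have "\<dots> < \<infinity>"
      proof -
        have "emeasure lborel (\<psi> k -` {y}) < \<infinity>" if "y \<noteq> 0" for y
        proof -
          have level[measurable]: "\<psi> k -` {y} \<in> sets borel"
            using measurable_sets[OF m, of "{y}" k] by simp
          have "integrable lborel (\<lambda>u. \<bar>y\<bar> powr \<alpha> * indicator (\<psi> k -` {y}) u)"
          proof (rule Bochner_Integration.integrable_bound[OF L_alpha_integrable[OF L[of k]]])
            show "AE u in lborel. norm (\<bar>y\<bar> powr \<alpha> * indicator (\<psi> k -` {y}) u) \<le> norm (\<bar>\<psi> k u\<bar> powr \<alpha>)"
              by (rule AE_I2) (simp add: indicator_def)
          qed measurable
          from integrable_mult_right[OF this, of "inverse (\<bar>y\<bar> powr \<alpha>)"]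
          have "integrable lborel (indicator (\<psi> k -` {y}) :: real \<Rightarrow> real)"
            using that by (simp add: mult.assoc[symmetric])
          then show ?thesis using level by (subst (asm) integrable_indicator_iff) simp
        qed
        then show ?thesis using fin by (simp add: ennreal_sum_less_top)
      qed
      finally show "emeasure lborel {y \<in> space lborel. \<psi> k y \<noteq> 0} \<noteq> \<infinity>" by simp
    qed
  next
    have "(\<lambda>k. LINT u|lborel. \<bar>\<psi> k u - f u\<bar> powr \<alpha>) \<longlonglongrightarrow> (LINT u|(lborel :: real measure). 0)"
    proof (rule integral_dominated_convergence)
      show "integrable lborel (\<lambda>u. 2 powr \<alpha> * (2 powr \<alpha> * \<bar>f u\<bar> powr \<alpha> + \<bar>f u\<bar> powr \<alpha>))"
        using major L_alpha_integrable[OF f] by (intro integrable_mult_right Bochner_Integration.integrable_add)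
      show "AE u in lborel. norm (\<bar>\<psi> k u - f u\<bar> powr \<alpha>) \<le> 2 powr \<alpha> * (2 powr \<alpha> * \<bar>f u\<bar> powr \<alpha> + \<bar>f u\<bar> powr \<alpha>)" for k
      proof (rule AE_I2)
        fix u
        have "\<bar>\<psi> k u - f u\<bar> powr \<alpha> \<le> 2 powr \<alpha> * (\<bar>\<psi> k u\<bar> powr \<alpha> + \<bar>f u\<bar> powr \<alpha>)"
          using abs_add_powr_le[OF \<alpha>, of "\<psi> k u" "- f u"] by simp
        also have "\<dots> \<le> 2 powr \<alpha> * (2 powr \<alpha> * \<bar>f u\<bar> powr \<alpha> + \<bar>f u\<bar> powr \<alpha>)"
          using bdp[of k u] by (intro mult_left_mono add_mono) auto
        finally show "norm (\<bar>\<psi> k u - f u\<bar> powr \<alpha>) \<le> 2 powr \<alpha> * (2 powr \<alpha> * \<bar>f u\<bar> powr \<alpha> + \<bar>f u\<bar> powr \<alpha>)"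
          by simp
      qed
      show "AE u in lborel. (\<lambda>k. \<bar>\<psi> k u - f u\<bar> powr \<alpha>) \<longlonglongrightarrow> 0"
      proof (rule AE_I2)
        fix u
        have "(\<lambda>k. \<bar>\<psi> k u - f u\<bar>) \<longlonglongrightarrow> 0"
          using lim[of u] by (simp add: LIM_zero_iff tendsto_rabs_zero_iff)
        then show "(\<lambda>k. \<bar>\<psi> k u - f u\<bar> powr \<alpha>) \<longlonglongrightarrow> 0"
          using \<alpha> by (intro tendsto_zero_powrI[OF _ tendsto_const]) auto
      qed
    qed (use m fm in auto)
    then show "(\<lambda>k. L_alpha_modular \<alpha> (\<lambda>u. \<psi> k u - f u)) \<longlonglongrightarrow> 0" by (simp add: L_alpha_modular_def)
    show "(\<lambda>k. L_alpha_modular \<alpha> (\<psi> k)) \<longlonglongrightarrow> L_alpha_modular \<alpha> f"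
      unfolding L_alpha_modular_def
    proof (rule integral_dominated_convergence[OF _ _ major])
      show "AE u in lborel. (\<lambda>k. \<bar>\<psi> k u\<bar> powr \<alpha>) \<longlonglongrightarrow> \<bar>f u\<bar> powr \<alpha>"
        using lim \<alpha> by (intro AE_I2 tendsto_powr' tendsto_rabs tendsto_const) auto
    qed (use m fm bdp in auto)
  qed
qed

context SaS_random_measure
begin

lemma simple_stable_integral_diff_tail:
  assumes \<alpha>: "0 < \<alpha>" "\<alpha> \<le> 2" and \<epsilon>: "0 < \<epsilon>"
    and \<phi>: "Bochner_Integration.simple_bochner_integrable lborel \<phi>"
    and \<psi>: "Bochner_Integration.simple_bochner_integrable lborel \<psi>"
  shows "prob {\<omega> \<in> space P. \<epsilon> < \<bar>simple_stable_integral M \<phi> \<omega> - simple_stable_integral M \<psi> \<omega>\<bar>} \<le>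
    2 * L_alpha_modular \<alpha> (\<lambda>u. \<phi> u - \<psi> u) / (1 - exp (- \<epsilon>\<^sup>2 / 2))"
proof (rule stable_tail_bound[OF _ _ L_alpha_modular_nonneg \<alpha> \<epsilon>])
  note [measurable] = simple_stable_integral_measurable[OF \<phi>] simple_stable_integral_measurable[OF \<psi>]
  show "(\<lambda>\<omega>. simple_stable_integral M \<phi> \<omega> - simple_stable_integral M \<psi> \<omega>) \<in> borel_measurable P" by measurable
  have sb: "Bochner_Integration.simple_bochner_integrable lborel (\<lambda>u. \<phi> u - \<psi> u)"
    using simple_lincomb[OF \<phi> \<psi>, of 1 "-1"] by simp
  note [measurable] = simple_stable_integral_measurable[OF sb]
  fix \<theta>
  have "(CLINT \<omega>|P. iexp (\<theta> * (simple_stable_integral M \<phi> \<omega> - simple_stable_integral M \<psi> \<omega>))) =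
      (CLINT \<omega>|P. iexp (\<theta> * simple_stable_integral M (\<lambda>u. \<phi> u - \<psi> u) \<omega>))"
    using simple_stable_integral_lincomb[OF \<phi> \<psi>, of 1 "-1"]
    by (intro integral_cong_AE) (measurable, auto)
  then show "(CLINT \<omega>|P. iexp (\<theta> * (simple_stable_integral M \<phi> \<omega> - simple_stable_integral M \<psi> \<omega>))) =
      complex_of_real (exp (- (\<bar>\<theta>\<bar> powr \<alpha> * L_alpha_modular \<alpha> (\<lambda>u. \<phi> u - \<psi> u))))"
    by (simp only: char_simple_stable_integral[OF sb])
qed

text \<open>If the approximating sequence converges fast enough, the tail bound makes the probabilities
  of \<open>2\<^bsup>-k\<^esup> < \<bar>I (k + 1) - I k\<bar>\<close> summable for the integrals \<open>I k\<close>. By Borel-Cantelli the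
  increments \<open>I (k + 1) - I k\<close> are almost surely summable, so that \<open>I\<close> converges.\<close>

lemma stable_integral_AE_limit:
  assumes \<alpha>: "0 < \<alpha>" "\<alpha> \<le> 2" and f: "f \<in> L_alpha \<alpha>"
  obtains \<phi> Y where "\<And>k. Bochner_Integration.simple_bochner_integrable lborel (\<phi> k)"
    and "(\<lambda>k. L_alpha_modular \<alpha> (\<lambda>u. \<phi> k u - f u)) \<longlonglongrightarrow> 0"
    and "(\<lambda>k. L_alpha_modular \<alpha> (\<phi> k)) \<longlonglongrightarrow> L_alpha_modular \<alpha> f"
    and "Y \<in> borel_measurable P"
    and "AE \<omega> in P. (\<lambda>k. simple_stable_integral M (\<phi> k) \<omega>) \<longlonglongrightarrow> Y \<omega>"
proof -
  obtain \<psi> where sb\<psi>: "\<And>k. Bochner_Integration.simple_bochner_integrable lborel (\<psi> k)"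
    and conv: "(\<lambda>k. L_alpha_modular \<alpha> (\<lambda>u. \<psi> k u - f u)) \<longlonglongrightarrow> 0"
    and mod: "(\<lambda>k. L_alpha_modular \<alpha> (\<psi> k)) \<longlonglongrightarrow> L_alpha_modular \<alpha> f"
    using L_alpha_simple_approximation[OF \<alpha>(1) f] by blast
  \<comment> \<open>the threshold \<open>\<delta> k\<close> makes the tail bound at level \<open>2\<^bsup>-k\<^esup>\<close> at most a multiple of \<open>2\<^bsup>-k\<^esup>\<close>\<close>
  define c where "c k = 1 - exp (- ((1/2) ^ k)\<^sup>2 / 2 :: real)" for k :: nat
  define \<delta> where "\<delta> k = (1/2) ^ k * c k" for k
  have c: "0 < c k" for k by (simp add: c_def)
  then have \<delta>: "0 < \<delta> k" for k by (simp add: \<delta>_def)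
  \<comment> \<open>meeting all thresholds up to \<open>k\<close> lets \<open>\<delta> k\<close> serve for both ends of the step from \<open>k\<close> to \<open>k + 1\<close>\<close>
  have "\<exists>m\<ge>k. \<forall>j\<le>k. L_alpha_modular \<alpha> (\<lambda>u. \<psi> m u - f u) < \<delta> j" for k
  proof -
    have "eventually (\<lambda>m. \<forall>j\<in>{..k}. L_alpha_modular \<alpha> (\<lambda>u. \<psi> m u - f u) < \<delta> j) sequentially"
      using \<delta> by (intro eventually_ball_finite ballI order_tendstoD(2)[OF conv]) auto
    then have "eventually (\<lambda>m. k \<le> m \<and> (\<forall>j\<in>{..k}. L_alpha_modular \<alpha> (\<lambda>u. \<psi> m u - f u) < \<delta> j)) sequentially"
      by (intro eventually_conj eventually_ge_at_top)
    from eventually_happens[OF this] show ?thesis by auto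
  qed
  then obtain r where r: "\<And>k. k \<le> r k" "\<And>k j. j \<le> k \<Longrightarrow> L_alpha_modular \<alpha> (\<lambda>u. \<psi> (r k) u - f u) < \<delta> j"
    by metis
  have r_inf: "filterlim r at_top sequentially"
    by (rule filterlim_at_top_mono[OF filterlim_ident]) (use r(1) in auto)
  define \<phi> where "\<phi> k = \<psi> (r k)" for k
  have sb: "Bochner_Integration.simple_bochner_integrable lborel (\<phi> k)" for k by (simp add: \<phi>_def sb\<psi>)
  let ?I = "\<lambda>k. simple_stable_integral M (\<phi> k)"
  note [measurable] = simple_stable_integral_measurable[OF sb]
  let ?A = "\<lambda>k. {\<omega> \<in> space P. (1/2) ^ k < \<bar>?I (Suc k) \<omega> - ?I k \<omega>\<bar>}"
  define C where "C = 2 * (2 powr \<alpha> * 2)"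
  have step: "prob (?A k) \<le> C * (1/2) ^ k" for k
  proof -
    have L: "(\<lambda>u. \<phi> k u - f u) \<in> L_alpha \<alpha>" for k
      using L_alpha_add[OF \<alpha>(1) simple_in_L_alpha[OF sb[of k]] L_alpha_cmult[OF f, of "-1"]] by simp
    have "L_alpha_modular \<alpha> (\<lambda>u. \<phi> (Suc k) u - \<phi> k u) =
        L_alpha_modular \<alpha> (\<lambda>u. (\<phi> (Suc k) u - f u) - (\<phi> k u - f u))" by simp
    also have "\<dots> \<le> 2 powr \<alpha> *
        (L_alpha_modular \<alpha> (\<lambda>u. \<phi> (Suc k) u - f u) + L_alpha_modular \<alpha> (\<lambda>u. \<phi> k u - f u))"
      by (rule L_alpha_modular_diff_le[OF \<alpha>(1) L L])
    also have "\<dots> \<le> 2 powr \<alpha> * (\<delta> k + \<delta> k)"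
      using r(2)[of k "Suc k"] r(2)[of k k] by (intro mult_left_mono add_mono) (auto simp: \<phi>_def)
    finally have le: "L_alpha_modular \<alpha> (\<lambda>u. \<phi> (Suc k) u - \<phi> k u) \<le> 2 powr \<alpha> * (\<delta> k + \<delta> k)" .
    have mod_le: "2 * L_alpha_modular \<alpha> (\<lambda>u. \<phi> (Suc k) u - \<phi> k u) \<le> C * \<delta> k"
    proof -
      have "C * \<delta> k = 2 * (2 powr \<alpha> * (\<delta> k + \<delta> k))" by (simp add: C_def)
      then show ?thesis using le by linarith
    qed
    have "prob (?A k) \<le> 2 * L_alpha_modular \<alpha> (\<lambda>u. \<phi> (Suc k) u - \<phi> k u) / c k"
      unfolding c_def by (rule simple_stable_integral_diff_tail[OF \<alpha> _ sb sb]) simp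
    also have "\<dots> \<le> C * \<delta> k / c k" using mod_le c[of k] by (intro divide_right_mono) auto
    also have "\<dots> = C * (1/2) ^ k" using c[of k] by (simp add: \<delta>_def)
    finally show ?thesis .
  qed
  have "summable (\<lambda>k. C * (1/2) ^ k)" by (intro summable_mult summable_geometric) auto
  then have "summable (\<lambda>k. prob (?A k))"
    by (rule summable_comparison_test'[of _ 0]) (use step in auto)
  then have "AE \<omega> in P. eventually (\<lambda>k. \<omega> \<in> space P - ?A k) sequentially"
    by (intro borel_cantelli_AE1) (auto simp: less_top[symmetric])
  then have lim: "AE \<omega> in P. (\<lambda>k. ?I k \<omega>) \<longlonglongrightarrow> lim (\<lambda>k. ?I k \<omega>)"
  proof eventually_elim
    case (elim \<omega>)
    then have "eventually (\<lambda>k. norm (?I (Suc k) \<omega> - ?I k \<omega>) \<le> (1/2) ^ k) sequentially"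
      by eventually_elim auto
    then have "summable (\<lambda>k. ?I (Suc k) \<omega> - ?I k \<omega>)"
      by (rule summable_comparison_test_ev) (intro summable_geometric, simp)
    then have "convergent (\<lambda>k. \<Sum>j<k. ?I (Suc j) \<omega> - ?I j \<omega>)" by (simp add: summable_iff_convergent)
    then have "convergent (\<lambda>k. ?I k \<omega> - ?I 0 \<omega>)" by (simp only: sum_lessThan_telescope[of "\<lambda>k. ?I k \<omega>"])
    then have "convergent (\<lambda>k. ?I k \<omega>)" by (simp only: convergent_diff_const_right_iff)
    then show ?case by (simp add: convergent_LIMSEQ_iff)
  qed
  show ?thesis
  proof (rule that[OF sb _ _ _ lim])
    show "(\<lambda>k. L_alpha_modular \<alpha> (\<lambda>u. \<phi> k u - f u)) \<longlonglongrightarrow> 0"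
      unfolding \<phi>_def by (rule filterlim_compose[OF conv r_inf])
    show "(\<lambda>k. L_alpha_modular \<alpha> (\<phi> k)) \<longlonglongrightarrow> L_alpha_modular \<alpha> f"
      unfolding \<phi>_def by (rule filterlim_compose[OF mod r_inf])
    show "(\<lambda>\<omega>. lim (\<lambda>k. ?I k \<omega>)) \<in> borel_measurable P" by measurable
  qed
qed

lemma has_stable_integral_lincomb:
  assumes \<alpha>: "0 < \<alpha>" and f: "has_stable_integral P \<alpha> M f Y" and g: "has_stable_integral P \<alpha> M g Z"
  shows "has_stable_integral P \<alpha> M (\<lambda>u. a * f u + b * g u) (\<lambda>\<omega>. a * Y \<omega> + b * Z \<omega>)"
proof -
  from f obtain \<phi> where \<phi>: "f \<in> L_alpha \<alpha>" "Y \<in> borel_measurable P"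
      "\<And>k. Bochner_Integration.simple_bochner_integrable lborel (\<phi> k)"
      "(\<lambda>k. L_alpha_modular \<alpha> (\<lambda>u. \<phi> k u - f u)) \<longlonglongrightarrow> 0"
      "tendsto_in_probability P (\<lambda>k. simple_stable_integral M (\<phi> k)) Y"
    unfolding has_stable_integral_def L_alpha_modular_def by blast
  from g obtain \<psi> where \<psi>: "g \<in> L_alpha \<alpha>" "Z \<in> borel_measurable P"
      "\<And>k. Bochner_Integration.simple_bochner_integrable lborel (\<psi> k)"
      "(\<lambda>k. L_alpha_modular \<alpha> (\<lambda>u. \<psi> k u - g u)) \<longlonglongrightarrow> 0"
      "tendsto_in_probability P (\<lambda>k. simple_stable_integral M (\<psi> k)) Z"
    unfolding has_stable_integral_def L_alpha_modular_def by blast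
  let ?\<chi> = "\<lambda>k u. a * \<phi> k u + b * \<psi> k u"
  have "(\<lambda>k. L_alpha_modular \<alpha> (\<lambda>u. ?\<chi> k u - (a * f u + b * g u))) \<longlonglongrightarrow> 0"
  proof (rule tendsto_sandwich[OF _ _ tendsto_const])
    show "eventually (\<lambda>k. 0 \<le> L_alpha_modular \<alpha> (\<lambda>u. ?\<chi> k u - (a * f u + b * g u))) sequentially"
      by (simp add: L_alpha_modular_nonneg)
    let ?B = "\<lambda>k. 2 powr \<alpha> * (\<bar>a\<bar> powr \<alpha> * L_alpha_modular \<alpha> (\<lambda>u. \<phi> k u - f u) +
        \<bar>- b\<bar> powr \<alpha> * L_alpha_modular \<alpha> (\<lambda>u. \<psi> k u - g u))"
    have "L_alpha_modular \<alpha> (\<lambda>u. ?\<chi> k u - (a * f u + b * g u)) \<le> ?B k" for k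
    proof -
      have L1: "(\<lambda>u. a * (\<phi> k u - f u)) \<in> L_alpha \<alpha>"
        using L_alpha_cmult[OF L_alpha_add[OF \<alpha> simple_in_L_alpha[OF \<phi>(3)] L_alpha_cmult[OF \<phi>(1), of "-1"]], of a] by simp
      have L2: "(\<lambda>u. - b * (\<psi> k u - g u)) \<in> L_alpha \<alpha>"
        using L_alpha_cmult[OF L_alpha_add[OF \<alpha> simple_in_L_alpha[OF \<psi>(3)] L_alpha_cmult[OF \<psi>(1), of "-1"]], of "-b"] by simp
      have "L_alpha_modular \<alpha> (\<lambda>u. ?\<chi> k u - (a * f u + b * g u)) =
          L_alpha_modular \<alpha> (\<lambda>u. a * (\<phi> k u - f u) - (- b * (\<psi> k u - g u)))"
        by (intro arg_cong[where f="L_alpha_modular \<alpha>"] ext) (simp add: algebra_simps)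
      also have "\<dots> \<le> ?B k"
        using L_alpha_modular_diff_le[OF \<alpha> L1 L2] by (simp only: L_alpha_modular_cmult)
      finally show ?thesis .
    qed
    then show "eventually (\<lambda>k. L_alpha_modular \<alpha> (\<lambda>u. ?\<chi> k u - (a * f u + b * g u)) \<le> ?B k) sequentially"
      by simp
    have "?B \<longlonglongrightarrow> 2 powr \<alpha> * (\<bar>a\<bar> powr \<alpha> * 0 + \<bar>- b\<bar> powr \<alpha> * 0)"
      by (intro tendsto_intros \<phi>(4) \<psi>(4))
    then show "?B \<longlonglongrightarrow> 0" by simp
  qed
  moreover have "tendsto_in_probability P (\<lambda>k. simple_stable_integral M (?\<chi> k)) (\<lambda>\<omega>. a * Y \<omega> + b * Z \<omega>)"
    by (rule tendsto_in_probability_lincomb[OF prob_space_axioms _ \<phi>(2) _ \<psi>(2) \<phi>(5) \<psi>(5)])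
       (auto intro!: simple_stable_integral_measurable \<phi>(3) \<psi>(3) simple_stable_integral_lincomb)
  moreover have "(\<lambda>u. a * f u + b * g u) \<in> L_alpha \<alpha>"
    by (intro L_alpha_add[OF \<alpha>] L_alpha_cmult \<phi>(1) \<psi>(1))
  moreover have "(\<lambda>\<omega>. a * Y \<omega> + b * Z \<omega>) \<in> borel_measurable P" using \<phi>(2) \<psi>(2) by measurable
  ultimately show ?thesis
    unfolding has_stable_integral_def L_alpha_modular_def
    by (intro conjI exI[of _ ?\<chi>]) (auto intro!: simple_lincomb \<phi>(3) \<psi>(3))
qed

text \<open>By the tail bound, integrals of simple functions tending to \<open>0\<close> in \<open>L\<^sup>\<alpha>\<close> also tend to \<open>0\<close> in
  probability. Limits in probability are unique.\<close>

lemma has_stable_integral_zero_imp_AE_zero: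
  assumes \<alpha>: "0 < \<alpha>" "\<alpha> \<le> 2" and Y: "has_stable_integral P \<alpha> M (\<lambda>_. 0) Y"
  shows "AE \<omega> in P. Y \<omega> = 0"
proof -
  from Y obtain \<phi> where [measurable]: "Y \<in> borel_measurable P"
      and sb: "\<And>k. Bochner_Integration.simple_bochner_integrable lborel (\<phi> k)"
      and mod: "(\<lambda>k. L_alpha_modular \<alpha> (\<phi> k)) \<longlonglongrightarrow> 0"
      and tip: "tendsto_in_probability P (\<lambda>k. simple_stable_integral M (\<phi> k)) Y"
    unfolding has_stable_integral_def L_alpha_modular_def by auto
  note [measurable] = simple_stable_integral_measurable[OF sb]
  have zero: "tendsto_in_probability P (\<lambda>k. simple_stable_integral M (\<phi> k)) (\<lambda>_. 0)"
    unfolding tendsto_in_probability_def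
  proof (intro allI impI)
    fix \<epsilon> :: real assume \<epsilon>: "0 < \<epsilon>"
    let ?b = "\<lambda>k. 2 * L_alpha_modular \<alpha> (\<phi> k) / (1 - exp (- \<epsilon>\<^sup>2 / 2))"
    have le: "prob {\<omega> \<in> space P. \<epsilon> < \<bar>simple_stable_integral M (\<phi> k) \<omega> - 0\<bar>} \<le> ?b k" for k
      using stable_tail_bound[OF simple_stable_integral_measurable[OF sb] char_simple_stable_integral[OF sb]
          L_alpha_modular_nonneg \<alpha> \<epsilon>] by simp
    have "?b \<longlonglongrightarrow> 2 * 0 / (1 - exp (- \<epsilon>\<^sup>2 / 2))"
      using \<epsilon> by (intro tendsto_intros mod) auto
    then have lim: "?b \<longlonglongrightarrow> 0" by simp
    show "(\<lambda>k. prob {\<omega> \<in> space P. \<epsilon> < \<bar>simple_stable_integral M (\<phi> k) \<omega> - 0\<bar>}) \<longlonglongrightarrow> 0"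
      by (rule tendsto_sandwich[OF _ _ tendsto_const lim])
        (rule always_eventually, rule allI, (rule measure_nonneg le))+
  qed
  have "tendsto_in_probability P (\<lambda>_ _. 0) (\<lambda>\<omega>. 1 * Y \<omega> + (- 1) * 0)"
    by (rule tendsto_in_probability_lincomb[OF prob_space_axioms _ _ _ _ tip zero]) auto
  then have "prob {\<omega> \<in> space P. \<epsilon> < \<bar>Y \<omega>\<bar>} = 0" if "0 < \<epsilon>" for \<epsilon>
    using that unfolding tendsto_in_probability_def by (auto simp: LIMSEQ_const_iff)
  then have "AE \<omega> in P. \<not> inverse (real (Suc m)) < \<bar>Y \<omega>\<bar>" for m
    by (intro AE_I[where N="{\<omega> \<in> space P. inverse (real (Suc m)) < \<bar>Y \<omega>\<bar>}"]) (auto simp: emeasure_eq_measure)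
  then have "AE \<omega> in P. \<forall>m. \<not> inverse (real (Suc m)) < \<bar>Y \<omega>\<bar>" by (simp add: AE_all_countable)
  then show ?thesis
    by eventually_elim (metis reals_Archimedean zero_less_abs_iff)
qed

lemma has_stable_integral_unique:
  assumes \<alpha>: "0 < \<alpha>" "\<alpha> \<le> 2"
    and "has_stable_integral P \<alpha> M f Y" "has_stable_integral P \<alpha> M f Z"
  shows "AE \<omega> in P. Y \<omega> = Z \<omega>"
proof -
  have "has_stable_integral P \<alpha> M (\<lambda>u. 1 * f u + (-1) * f u) (\<lambda>\<omega>. 1 * Y \<omega> + (-1) * Z \<omega>)"
    by (rule has_stable_integral_lincomb[OF \<alpha>(1) assms(3,4)])
  then have "has_stable_integral P \<alpha> M (\<lambda>_. 0) (\<lambda>\<omega>. Y \<omega> - Z \<omega>)" by simp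
  from has_stable_integral_zero_imp_AE_zero[OF \<alpha> this] show ?thesis by simp
qed

text \<open>The version constructed as an almost sure limit admits dominated convergence of the
  characteristic functions.\<close>

lemma has_stable_integral_exists_char:
  assumes \<alpha>: "0 < \<alpha>" "\<alpha> \<le> 2" and f: "f \<in> L_alpha \<alpha>"
  obtains Y where "has_stable_integral P \<alpha> M f Y"
    and "\<And>\<theta>. (CLINT \<omega>|P. iexp (\<theta> * Y \<omega>)) = complex_of_real (exp (- (\<bar>\<theta>\<bar> powr \<alpha> * L_alpha_modular \<alpha> f)))"
proof -
  from stable_integral_AE_limit[OF \<alpha> f] obtain \<phi> Y
    where sb: "\<And>k. Bochner_Integration.simple_bochner_integrable lborel (\<phi> k)"
    and conv: "(\<lambda>k. L_alpha_modular \<alpha> (\<lambda>u. \<phi> k u - f u)) \<longlonglongrightarrow> 0"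
    and mod: "(\<lambda>k. L_alpha_modular \<alpha> (\<phi> k)) \<longlonglongrightarrow> L_alpha_modular \<alpha> f"
    and Y[measurable]: "Y \<in> borel_measurable P"
    and lim: "AE \<omega> in P. (\<lambda>k. simple_stable_integral M (\<phi> k) \<omega>) \<longlonglongrightarrow> Y \<omega>" by blast
  note [measurable] = simple_stable_integral_measurable[OF sb]
  show ?thesis
  proof (rule that)
    have "tendsto_in_probability P (\<lambda>k. simple_stable_integral M (\<phi> k)) Y"
      by (rule AE_tendsto_imp_tendsto_in_probability[OF prob_space_axioms _ Y lim]) measurable
    then show "has_stable_integral P \<alpha> M f Y"
      using f Y sb conv unfolding has_stable_integral_def L_alpha_modular_def by blast
  next
    fix \<theta>
    have "(\<lambda>k. CLINT \<omega>|P. iexp (\<theta> * simple_stable_integral M (\<phi> k) \<omega>)) \<longlonglongrightarrow> (CLINT \<omega>|P. iexp (\<theta> * Y \<omega>))"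
    proof (rule integral_dominated_convergence[where w="\<lambda>_. 1"])
      show "AE \<omega> in P. (\<lambda>k. iexp (\<theta> * simple_stable_integral M (\<phi> k) \<omega>)) \<longlonglongrightarrow> iexp (\<theta> * Y \<omega>)"
        using lim by eventually_elim (intro tendsto_intros)
    qed (auto simp: norm_exp_i_times simp flip: of_real_mult)
    moreover have "(\<lambda>k. CLINT \<omega>|P. iexp (\<theta> * simple_stable_integral M (\<phi> k) \<omega>)) \<longlonglongrightarrow>
        complex_of_real (exp (- (\<bar>\<theta>\<bar> powr \<alpha> * L_alpha_modular \<alpha> f)))"
      unfolding char_simple_stable_integral[OF sb] by (intro tendsto_intros mod)
    ultimately show "(CLINT \<omega>|P. iexp (\<theta> * Y \<omega>)) = complex_of_real (exp (- (\<bar>\<theta>\<bar> powr \<alpha> * L_alpha_modular \<alpha> f)))"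
      by (rule LIMSEQ_unique)
  qed
qed

text \<open>Any version agrees almost surely with the one whose characteristic function is known.\<close>

lemma char_stable_integral:
  assumes \<alpha>: "0 < \<alpha>" "\<alpha> \<le> 2" and Y: "has_stable_integral P \<alpha> M f Y"
  shows "(CLINT \<omega>|P. iexp (\<theta> * Y \<omega>)) = complex_of_real (exp (- (\<bar>\<theta>\<bar> powr \<alpha> * L_alpha_modular \<alpha> f)))"
proof -
  have "f \<in> L_alpha \<alpha>" using Y by (simp add: has_stable_integral_def)
  then obtain Z where Z: "has_stable_integral P \<alpha> M f Z"
    and char: "(CLINT \<omega>|P. iexp (\<theta> * Z \<omega>)) = complex_of_real (exp (- (\<bar>\<theta>\<bar> powr \<alpha> * L_alpha_modular \<alpha> f)))"
    by (rule has_stable_integral_exists_char[OF \<alpha>]) blast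
  have [measurable]: "Y \<in> borel_measurable P" "Z \<in> borel_measurable P"
    using Y Z by (auto simp: has_stable_integral_def)
  have "(CLINT \<omega>|P. iexp (\<theta> * Y \<omega>)) = (CLINT \<omega>|P. iexp (\<theta> * Z \<omega>))"
    using has_stable_integral_unique[OF \<alpha> Y Z] by (intro integral_cong_AE) auto
  with char show ?thesis by simp
qed

lemma has_stable_integral_stable_integral:
  assumes \<alpha>: "0 < \<alpha>" "\<alpha> \<le> 2" and f: "f \<in> L_alpha \<alpha>"
  shows "has_stable_integral P \<alpha> M f (stable_integral P \<alpha> M f)"
proof -
  obtain Y where "has_stable_integral P \<alpha> M f Y" by (rule has_stable_integral_exists_char[OF \<alpha> f])
  then show ?thesis unfolding stable_integral_def by (rule someI[where P="has_stable_integral P \<alpha> M f"])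
qed

lemma has_stable_integral_sum:
  assumes \<alpha>: "0 < \<alpha>" "\<alpha> \<le> 2" and "finite J" and "\<And>j. j \<in> J \<Longrightarrow> has_stable_integral P \<alpha> M (f j) (Y j)"
  shows "has_stable_integral P \<alpha> M (\<lambda>u. \<Sum>j\<in>J. \<theta> j * f j u) (\<lambda>\<omega>. \<Sum>j\<in>J. \<theta> j * Y j \<omega>)"
  using assms(3,4)
proof (induction J)
  case empty
  have "(\<lambda>_. 0) \<in> L_alpha \<alpha>" by (simp add: L_alpha_def)
  from has_stable_integral_stable_integral[OF \<alpha> this]
  show ?case using has_stable_integral_lincomb[OF \<alpha>(1), of "\<lambda>_. 0" _ "\<lambda>_. 0" _ 0 0] by simp
next
  case (insert j J)
  then show ?case
    using has_stable_integral_lincomb[OF \<alpha>(1), of "f j" "Y j" "\<lambda>u. \<Sum>j\<in>J. \<theta> j * f j u"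
        "\<lambda>\<omega>. \<Sum>j\<in>J. \<theta> j * Y j \<omega>" "\<theta> j" 1] by simp
qed

lemma char_stable_integral_sum:
  assumes \<alpha>: "0 < \<alpha>" "\<alpha> \<le> 2" and "finite J" and "\<And>j. j \<in> J \<Longrightarrow> has_stable_integral P \<alpha> M (f j) (Y j)"
  shows "(CLINT \<omega>|P. iexp (\<Sum>j\<in>J. \<theta> j * Y j \<omega>)) =
    complex_of_real (exp (- L_alpha_modular \<alpha> (\<lambda>u. \<Sum>j\<in>J. \<theta> j * f j u)))"
proof -
  have "has_stable_integral P \<alpha> M (\<lambda>u. \<Sum>j\<in>J. \<theta> j * f j u) (\<lambda>\<omega>. \<Sum>j\<in>J. \<theta> j * Y j \<omega>)"
    by (rule has_stable_integral_sum[OF \<alpha> assms(3)]) (rule assms(4))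
  from char_stable_integral[OF \<alpha> this, where \<theta>=1] show ?thesis by simp
qed

end


section \<open>Characteristic functions determine joint laws\<close>

text \<open>A signed weight \<open>W\<close> with \<open>\<bar>W\<bar> \<le> 1\<close> is turned into a probability density by adding \<open>2\<close>; the
  constant \<open>2\<close> rather than \<open>1\<close> keeps the total mass \<open>c\<close> away from \<open>0\<close>. This
  brings weighted laws within the reach of uniqueness theorems for probability measures.\<close>

lemma tilted_law:
  fixes X W :: "'a \<Rightarrow> real"
  assumes "prob_space P" and X [measurable]: "X \<in> borel_measurable P"
    and W [measurable]: "W \<in> borel_measurable P" and W1: "\<And>\<omega>. \<bar>W \<omega>\<bar> \<le> 1"
    and c: "c = 2 + (LINT \<omega>|P. W \<omega>)"
  defines "\<mu> \<equiv> distr (density P (\<lambda>\<omega>. ennreal ((2 + W \<omega>) / c))) borel X"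
  shows "real_distribution \<mu>"
    and "char \<mu> \<theta> = (2 * (CLINT \<omega>|P. iexp (\<theta> * X \<omega>)) + (CLINT \<omega>|P. of_real (W \<omega>) * iexp (\<theta> * X \<omega>))) / of_real c"
    and "A \<in> sets borel \<Longrightarrow> measure \<mu> A =
      (2 * (LINT \<omega>|P. indicator A (X \<omega>)) + (LINT \<omega>|P. W \<omega> * indicator A (X \<omega>))) / c"
    and "1 \<le> c"
proof -
  interpret prob_space P by fact
  have iW: "integrable P W"
    by (rule integrable_const_bound[where B=1]) (use W1 in auto)
  have "-1 \<le> (LINT \<omega>|P. W \<omega>)"
    using integral_mono[OF _ iW, of "\<lambda>_. -1"] W1 by (simp add: abs_le_iff minus_le_iff prob_space)
  then show c1: "1 \<le> c" using c by simp
  have pos: "0 \<le> (2 + W \<omega>) / c" for \<omega> using W1[of \<omega>] c1 by (auto simp: abs_le_iff)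
  let ?D = "density P (\<lambda>\<omega>. ennreal ((2 + W \<omega>) / c))"
  have "emeasure ?D (space ?D) = (\<integral>\<^sup>+ \<omega>. ennreal ((2 + W \<omega>) / c) \<partial>P)"
    by (simp add: emeasure_density cong: nn_integral_cong)
  also have "\<dots> = ennreal (LINT \<omega>|P. (2 + W \<omega>) / c)"
    by (rule nn_integral_eq_integral) (use iW pos in auto)
  also have "\<dots> = 1" using c c1 iW by (simp add: prob_space)
  finally have pD: "prob_space ?D" by (rule prob_spaceI)
  show "real_distribution \<mu>" unfolding \<mu>_def
    by (rule prob_space.real_distribution_distr[OF pD]) simp
  have bd: "integrable P (\<lambda>\<omega>. iexp (\<theta> * X \<omega>))"
    by (rule integrable_const_bound[where B=1]) (use norm_exp_i_times in \<open>auto\<close>)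
  have bdW: "integrable P (\<lambda>\<omega>. of_real (W \<omega>) * iexp (\<theta> * X \<omega>))"
    by (rule integrable_const_bound[where B=1])
       (use W1 norm_exp_i_times[of "\<theta> * X _"] in \<open>auto simp: norm_mult\<close>)
  have "char \<mu> \<theta> = (CLINT \<omega>|P. ((2 + W \<omega>) / c) *\<^sub>R iexp (\<theta> * X \<omega>))"
    unfolding \<mu>_def char_def by (simp add: integral_distr integral_density pos)
  also have "\<dots> = (CLINT \<omega>|P. (2 * iexp (\<theta> * X \<omega>) + of_real (W \<omega>) * iexp (\<theta> * X \<omega>)) / of_real c)"
    by (intro Bochner_Integration.integral_cong) (auto simp: scaleR_conv_of_real field_simps)
  also have "\<dots> = (2 * (CLINT \<omega>|P. iexp (\<theta> * X \<omega>)) + (CLINT \<omega>|P. of_real (W \<omega>) * iexp (\<theta> * X \<omega>))) / of_real c"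
    using bd bdW by simp
  finally show "char \<mu> \<theta> = \<dots>" .
  assume A[measurable]: "A \<in> sets borel"
  have i1: "integrable P (\<lambda>\<omega>. indicator A (X \<omega>) :: real)"
    by (rule integrable_const_bound[where B=1]) (auto simp: indicator_def)
  have i2: "integrable P (\<lambda>\<omega>. W \<omega> * indicator A (X \<omega>) :: real)"
    by (rule integrable_const_bound[where B=1]) (use W1 in \<open>auto simp: indicator_def\<close>)
  interpret \<mu>: real_distribution \<mu> by fact
  have "measure \<mu> A = (LINT x|\<mu>. indicator A x)" by simp
  also have "\<dots> = (LINT \<omega>|P. ((2 + W \<omega>) / c) * indicator A (X \<omega>))"
    unfolding \<mu>_def by (subst integral_distr, simp, simp, subst integral_density) (auto simp: pos)
  also have "\<dots> = (LINT \<omega>|P. (2 * indicator A (X \<omega>) + W \<omega> * indicator A (X \<omega>)) / c)"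
    by (intro Bochner_Integration.integral_cong) (auto simp: field_simps)
  also have "\<dots> = (2 * (LINT \<omega>|P. indicator A (X \<omega>)) + (LINT \<omega>|P. W \<omega> * indicator A (X \<omega>))) / c"
    using i1 i2 by simp
  finally show "measure \<mu> A = \<dots>" .
qed

text \<open>Levy's uniqueness theorem applies to the laws under the tilted measures and to
  the untilted laws. The difference of the two conclusions concerns \<open>W\<close> and \<open>V\<close> alone.\<close>

lemma weighted_char_uniqueness:
  fixes X W :: "'a \<Rightarrow> real" and Y V :: "'b \<Rightarrow> real"
  assumes P: "prob_space P" and X: "X \<in> borel_measurable P"
    and W: "W \<in> borel_measurable P" "\<And>\<omega>. \<bar>W \<omega>\<bar> \<le> 1"
    and Q: "prob_space Q" and Y: "Y \<in> borel_measurable Q"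
    and V: "V \<in> borel_measurable Q" "\<And>\<omega>. \<bar>V \<omega>\<bar> \<le> 1"
    and eq: "\<And>\<theta>. (CLINT \<omega>|P. iexp (\<theta> * X \<omega>)) = (CLINT \<omega>|Q. iexp (\<theta> * Y \<omega>))"
    and weq: "\<And>\<theta>. (CLINT \<omega>|P. of_real (W \<omega>) * iexp (\<theta> * X \<omega>)) = (CLINT \<omega>|Q. of_real (V \<omega>) * iexp (\<theta> * Y \<omega>))"
    and A: "A \<in> sets borel"
  shows "(LINT \<omega>|P. W \<omega> * indicator A (X \<omega>)) = (LINT \<omega>|Q. V \<omega> * indicator A (Y \<omega>))"
proof -
  \<comment> \<open>at frequency \<open>0\<close>: both tilted measures are normalised by the same constant\<close>
  have mean: "(LINT \<omega>|P. W \<omega>) = (LINT \<omega>|Q. V \<omega>)"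
    using weq[of 0] by (simp add: integral_complex_of_real)
  define c where "c = 2 + (LINT \<omega>|P. W \<omega>)"
  have c': "c = 2 + (LINT \<omega>|Q. V \<omega>)" using mean c_def by simp
  note tP = tilted_law[OF P X W c_def] and tQ = tilted_law[OF Q Y V c']
  have tilted: "2 * (LINT \<omega>|P. indicator A (X \<omega>)) + (LINT \<omega>|P. W \<omega> * indicator A (X \<omega>)) =
      2 * (LINT \<omega>|Q. indicator A (Y \<omega>)) + (LINT \<omega>|Q. V \<omega> * indicator A (Y \<omega>))"
  proof -
    note laws = Levy_uniqueness[OF tP(1) tQ(1) ext, unfolded tP(2) tQ(2) eq weq, OF refl]
    show ?thesis using tP(3)[OF A] tQ(3)[OF A] tP(4) by (simp add: laws)
  qed
  have "distr P borel X = distr Q borel Y"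
    using eq X Y
    by (intro Levy_uniqueness prob_space.real_distribution_distr P Q)
       (auto simp: char_def integral_distr)
  then have "(LINT x|distr P borel X. indicator A x :: real) = (LINT x|distr Q borel Y. indicator A x)"
    by simp
  then have "(LINT \<omega>|P. indicator A (X \<omega>)) = (LINT \<omega>|Q. indicator A (Y \<omega>) :: real)"
    using X Y A by (subst (asm) (1 2) integral_distr) auto
  with tilted show ?thesis by simp
qed

text \<open>The cosine and sine of the remaining coordinates are real weights, as the tilting argument
  requires, and are combinations of exponentials with both signs of the frequency, to which the
  induction hypothesis applies.\<close>

lemma of_real_cos_times_iexp:
  fixes a x y :: real
  shows "of_real (a * cos y) * iexp x = (of_real a * iexp (x + 1 * y) + of_real a * iexp (x + (-1) * y)) / 2"
proof -
  have "complex_of_real (cos y) = (iexp y + inverse (iexp y)) / 2"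
    using cos_exp_eq[of "of_real y"] by (simp add: cos_of_real exp_minus)
  moreover have "iexp (x + 1 * y) = iexp x * iexp y" "iexp (x + (-1) * y) = iexp x * inverse (iexp y)"
    by (simp_all add: exp_add[symmetric] exp_minus[symmetric] distrib_left right_diff_distrib exp_diff field_simps)
  ultimately show ?thesis by (simp only: of_real_mult) (simp add: field_simps)
qed

lemma of_real_sin_times_iexp:
  fixes a x y :: real
  shows "of_real (a * sin y) * iexp x = (of_real a * iexp (x + 1 * y) - of_real a * iexp (x + (-1) * y)) / (2 * \<i>)"
proof -
  have "complex_of_real (sin y) = (iexp y - inverse (iexp y)) / (2 * \<i>)"
    using sin_exp_eq[of "of_real y"] by (simp add: sin_of_real exp_minus)
  moreover have "iexp (x + 1 * y) = iexp x * iexp y" "iexp (x + (-1) * y) = iexp x * inverse (iexp y)"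
    by (simp_all add: exp_add[symmetric] exp_minus[symmetric] distrib_left right_diff_distrib exp_diff field_simps)
  ultimately show ?thesis by (simp only: of_real_mult) (simp add: field_simps)
qed

text \<open>Induction on \<open>K\<close>. Once the coordinates in \<open>K\<close> have been replaced by indicators, the
  coordinate \<open>k\<close> is treated as a single real variable. The other factors are bounded weights, whose
  real and imaginary parts are handled separately. For
  \<open>K = J\<close> the exponential is gone and the probabilities of rectangles remain.\<close>

lemma char_determines_rectangle_char:
  fixes \<xi> :: "'i \<Rightarrow> 'a \<Rightarrow> real" and \<eta> :: "'i \<Rightarrow> 'b \<Rightarrow> real"
  assumes P: "prob_space P" and Q: "prob_space Q" and J: "finite J"
    and \<xi> [measurable]: "\<And>j. j \<in> J \<Longrightarrow> \<xi> j \<in> borel_measurable P"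
    and \<eta> [measurable]: "\<And>j. j \<in> J \<Longrightarrow> \<eta> j \<in> borel_measurable Q"
    and char: "\<And>\<theta>. (CLINT \<omega>|P. iexp (\<Sum>j\<in>J. \<theta> j * \<xi> j \<omega>)) = (CLINT \<omega>|Q. iexp (\<Sum>j\<in>J. \<theta> j * \<eta> j \<omega>))"
    and "K \<subseteq> J" and "\<And>k. k \<in> K \<Longrightarrow> A k \<in> sets borel"
  shows "(CLINT \<omega>|P. of_real (\<Prod>k\<in>K. indicator (A k) (\<xi> k \<omega>)) * iexp (\<Sum>j\<in>J-K. \<theta> j * \<xi> j \<omega>)) =
    (CLINT \<omega>|Q. of_real (\<Prod>k\<in>K. indicator (A k) (\<eta> k \<omega>)) * iexp (\<Sum>j\<in>J-K. \<theta> j * \<eta> j \<omega>))"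
proof -
  have "finite K" using assms J finite_subset by blast
  then show ?thesis using assms(7,8)
  proof (induction K arbitrary: \<theta>)
    case empty
    then show ?case using char by simp
  next
    case (insert k K)
    have kJ: "k \<in> J" and KJ: "K \<subseteq> J" using insert.prems by auto
    have Ak[measurable]: "A k \<in> sets borel" using insert.prems by auto
    have AK[measurable]: "A j \<in> sets borel" if "j \<in> K" for j using insert.prems that by auto
    have KJ': "j \<in> K \<Longrightarrow> j \<in> J" for j using KJ by auto
    let ?L = "J - insert k K"
    have fL: "finite ?L" using J by auto
    define I S where "I = (\<lambda>\<xi> :: 'i \<Rightarrow> real. (\<Prod>k\<in>K. indicator (A k) (\<xi> k)) :: real)"
      and "S = (\<lambda>\<xi>. \<Sum>j\<in>?L. \<theta> j * (\<xi> j :: real))"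
    have I1: "\<bar>I x\<bar> \<le> 1" for x
      unfolding I_def abs_prod by (rule prod_le_1) (auto simp: indicator_def)
    have meas: "(\<lambda>\<omega>. I (\<lambda>j. \<zeta> j \<omega>)) \<in> borel_measurable R" "(\<lambda>\<omega>. S (\<lambda>j. \<zeta> j \<omega>)) \<in> borel_measurable R"
      if [measurable]: "\<And>j. j \<in> J \<Longrightarrow> \<zeta> j \<in> borel_measurable R" for R :: "'c measure" and \<zeta>
      unfolding I_def S_def using KJ' by measurable
    \<comment> \<open>the frequency of coordinate \<open>k\<close> is set to \<open>\<theta>k\<close>, and the others keep or change their sign with \<open>s\<close>\<close>
    have split: "of_real (I x) * iexp (\<theta>k * x k + s * S x) =
       of_real (I x) * iexp (\<Sum>j\<in>J-K. (if j = k then \<theta>k else s * \<theta> j) * x j)" for x \<theta>k s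
    proof -
      have L: "J - K = insert k ?L" "k \<notin> ?L" using kJ insert.hyps by auto
      have "(\<Sum>j\<in>J-K. (if j = k then \<theta>k else s * \<theta> j) * x j) = \<theta>k * x k +
          (\<Sum>j\<in>?L. (if j = k then \<theta>k else s * \<theta> j) * x j)"
        unfolding L(1) by (subst sum.insert[OF fL L(2)]) simp
      also have "(\<Sum>j\<in>?L. (if j = k then \<theta>k else s * \<theta> j) * x j) = s * S x"
        unfolding S_def sum_distrib_left by (intro sum.cong) auto
      finally show ?thesis by simp
    qed
    have split_integral: "(CLINT \<omega>|R. of_real (I (\<lambda>j. \<zeta> j \<omega>)) * iexp (\<theta>k * \<zeta> k \<omega> + s * S (\<lambda>j. \<zeta> j \<omega>))) =
       (CLINT \<omega>|R. of_real (\<Prod>k\<in>K. indicator (A k) (\<zeta> k \<omega>)) *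
         iexp (\<Sum>j\<in>J-K. (if j = k then \<theta>k else s * \<theta> j) * \<zeta> j \<omega>))"
      for R :: "'c measure" and \<zeta> \<theta>k s
      using split[of "\<lambda>j. \<zeta> j \<omega>" \<theta>k s for \<omega>]
      by (intro Bochner_Integration.integral_cong) (simp_all only: I_def)
    have IH: "(CLINT \<omega>|P. of_real (I (\<lambda>j. \<xi> j \<omega>)) * iexp (\<theta>k * \<xi> k \<omega> + s * S (\<lambda>j. \<xi> j \<omega>))) =
       (CLINT \<omega>|Q. of_real (I (\<lambda>j. \<eta> j \<omega>)) * iexp (\<theta>k * \<eta> k \<omega> + s * S (\<lambda>j. \<eta> j \<omega>)))" for \<theta>k s
      unfolding split_integral using insert.prems by (intro insert.IH[OF KJ]) auto
    have int: "integrable R (\<lambda>\<omega>. of_real (I (\<lambda>j. \<zeta> j \<omega>)) * iexp (\<theta>k * \<zeta> k \<omega> + s * S (\<lambda>j. \<zeta> j \<omega>)))"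
      if R: "prob_space R" and \<zeta>: "\<And>j. j \<in> J \<Longrightarrow> \<zeta> j \<in> borel_measurable R"
      for R :: "'c measure" and \<zeta> \<theta>k s
    proof -
      interpret prob_space R by fact
      note [measurable] = meas[of \<zeta>, OF \<zeta>] \<zeta>[OF kJ]
      show ?thesis
        by (rule integrable_const_bound[where B=1])
           (use I1 norm_exp_i_times[of "\<theta>k * \<zeta> k _ + s * S (\<lambda>j. \<zeta> j _)"] in \<open>auto simp: norm_mult simp del: of_real_add of_real_mult\<close>)
    qed
    have W: "(CLINT \<omega>|P. of_real (I (\<lambda>j. \<xi> j \<omega>) * cos (S (\<lambda>j. \<xi> j \<omega>))) * iexp (\<theta>k * \<xi> k \<omega>)) =
         (CLINT \<omega>|Q. of_real (I (\<lambda>j. \<eta> j \<omega>) * cos (S (\<lambda>j. \<eta> j \<omega>))) * iexp (\<theta>k * \<eta> k \<omega>))"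
       "(CLINT \<omega>|P. of_real (I (\<lambda>j. \<xi> j \<omega>) * sin (S (\<lambda>j. \<xi> j \<omega>))) * iexp (\<theta>k * \<xi> k \<omega>)) =
         (CLINT \<omega>|Q. of_real (I (\<lambda>j. \<eta> j \<omega>) * sin (S (\<lambda>j. \<eta> j \<omega>))) * iexp (\<theta>k * \<eta> k \<omega>))" for \<theta>k
      unfolding of_real_cos_times_iexp of_real_sin_times_iexp
      using int[of P \<xi>, OF P \<xi>] int[of Q \<eta>, OF Q \<eta>]
      by (simp_all only: integral_divide_zero Bochner_Integration.integral_add Bochner_Integration.integral_diff IH)
    have m: "(CLINT \<omega>|P. iexp (\<theta>k * \<xi> k \<omega>)) = (CLINT \<omega>|Q. iexp (\<theta>k * \<eta> k \<omega>))" for \<theta>k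
    proof -
      have "(\<Sum>j\<in>J. (if j = k then \<theta>k else 0) * x j) = \<theta>k * x k" for x :: "'i \<Rightarrow> real"
        using J kJ by (simp add: if_distrib[of "\<lambda>u. u * _"] sum.delta cong: if_cong)
      then show ?thesis using char[of "\<lambda>j. if j = k then \<theta>k else 0"] by simp
    qed
    have le1: "\<bar>I x * cos (S x)\<bar> \<le> 1" "\<bar>I x * sin (S x)\<bar> \<le> 1" for x
      using I1[of x] by (auto simp: abs_mult intro!: mult_le_one)
    note mP[measurable] = meas[of \<xi>, OF \<xi>] \<xi>[OF kJ] and mQ[measurable] = meas[of \<eta>, OF \<eta>] \<eta>[OF kJ]
    have C: "(LINT \<omega>|P. I (\<lambda>j. \<xi> j \<omega>) * cos (S (\<lambda>j. \<xi> j \<omega>)) * indicator (A k) (\<xi> k \<omega>)) =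
         (LINT \<omega>|Q. I (\<lambda>j. \<eta> j \<omega>) * cos (S (\<lambda>j. \<eta> j \<omega>)) * indicator (A k) (\<eta> k \<omega>))"
      by (rule weighted_char_uniqueness[OF P _ _ _ Q _ _ _ m W(1) Ak]) (use le1 in auto)
    have D: "(LINT \<omega>|P. I (\<lambda>j. \<xi> j \<omega>) * sin (S (\<lambda>j. \<xi> j \<omega>)) * indicator (A k) (\<xi> k \<omega>)) =
         (LINT \<omega>|Q. I (\<lambda>j. \<eta> j \<omega>) * sin (S (\<lambda>j. \<eta> j \<omega>)) * indicator (A k) (\<eta> k \<omega>))"
      by (rule weighted_char_uniqueness[OF P _ _ _ Q _ _ _ m W(2) Ak]) (use le1 in auto)
    have fin: "(CLINT \<omega>|R. of_real (\<Prod>k\<in>insert k K. indicator (A k) (\<zeta> k \<omega>)) * iexp (\<Sum>j\<in>?L. \<theta> j * \<zeta> j \<omega>)) =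
        of_real (LINT \<omega>|R. I (\<lambda>j. \<zeta> j \<omega>) * cos (S (\<lambda>j. \<zeta> j \<omega>)) * indicator (A k) (\<zeta> k \<omega>)) +
        \<i> * of_real (LINT \<omega>|R. I (\<lambda>j. \<zeta> j \<omega>) * sin (S (\<lambda>j. \<zeta> j \<omega>)) * indicator (A k) (\<zeta> k \<omega>))"
      if R: "prob_space R" and \<zeta>: "\<And>j. j \<in> J \<Longrightarrow> \<zeta> j \<in> borel_measurable R"
      for R :: "'c measure" and \<zeta>
    proof -
      interpret prob_space R by fact
      note [measurable] = meas[of \<zeta>, OF \<zeta>] \<zeta>[OF kJ]
      have i: "integrable R (\<lambda>\<omega>. I (\<lambda>j. \<zeta> j \<omega>) * cos (S (\<lambda>j. \<zeta> j \<omega>)) * indicator (A k) (\<zeta> k \<omega>))"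
        "integrable R (\<lambda>\<omega>. I (\<lambda>j. \<zeta> j \<omega>) * sin (S (\<lambda>j. \<zeta> j \<omega>)) * indicator (A k) (\<zeta> k \<omega>))"
        by (rule integrable_const_bound[where B=1]; use le1 in \<open>auto simp: indicator_def\<close>)+
      have "(CLINT \<omega>|R. of_real (\<Prod>k\<in>insert k K. indicator (A k) (\<zeta> k \<omega>)) * iexp (\<Sum>j\<in>?L. \<theta> j * \<zeta> j \<omega>)) =
        (CLINT \<omega>|R. of_real (I (\<lambda>j. \<zeta> j \<omega>) * cos (S (\<lambda>j. \<zeta> j \<omega>)) * indicator (A k) (\<zeta> k \<omega>)) +
         \<i> * of_real (I (\<lambda>j. \<zeta> j \<omega>) * sin (S (\<lambda>j. \<zeta> j \<omega>)) * indicator (A k) (\<zeta> k \<omega>)))"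
      proof (intro Bochner_Integration.integral_cong refl, goal_cases)
        case (1 \<omega>)
        have euler: "iexp y = of_real (cos y) + \<i> * of_real (sin y)" for y
          by (simp add: cis_conv_exp[symmetric] complex_eq_iff)
        have prod: "(\<Prod>k\<in>insert k K. indicator (A k) (\<zeta> k \<omega>)) = indicator (A k) (\<zeta> k \<omega>) * I (\<lambda>j. \<zeta> j \<omega>)"
          unfolding I_def using insert.hyps by simp
        have "(\<Sum>j\<in>?L. \<theta> j * \<zeta> j \<omega>) = S (\<lambda>j. \<zeta> j \<omega>)" by (simp add: S_def)
        then show ?case unfolding prod by (simp only: euler of_real_mult) (simp add: algebra_simps)
      qed
      then show ?thesis using i by (simp add: integral_complex_of_real del: of_real_mult)
    qed
    show ?case
      using fin[of P \<xi>] fin[of Q \<eta>] P Q \<xi> \<eta> C D by simp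
  qed
qed

text \<open>Rectangles generate the product \<open>\<sigma>\<close>-algebra and are closed under intersection.\<close>

theorem joint_law_eqI_char:
  fixes \<xi> :: "'i \<Rightarrow> 'a \<Rightarrow> real" and \<eta> :: "'i \<Rightarrow> 'b \<Rightarrow> real"
  assumes P: "prob_space P" and Q: "prob_space Q" and J: "finite J"
    and \<xi> [measurable]: "\<And>j. j \<in> J \<Longrightarrow> \<xi> j \<in> borel_measurable P"
    and \<eta> [measurable]: "\<And>j. j \<in> J \<Longrightarrow> \<eta> j \<in> borel_measurable Q"
    and char: "\<And>\<theta>. (CLINT \<omega>|P. iexp (\<Sum>j\<in>J. \<theta> j * \<xi> j \<omega>)) = (CLINT \<omega>|Q. iexp (\<Sum>j\<in>J. \<theta> j * \<eta> j \<omega>))"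
  shows "joint_law P J \<xi> = joint_law Q J \<eta>"
proof (rule measure_eqI_PiM_finite[OF J])
  show "sets (joint_law P J \<xi>) = sets (\<Pi>\<^sub>M j\<in>J. borel)" "sets (joint_law Q J \<eta>) = sets (\<Pi>\<^sub>M j\<in>J. borel)"
    by (simp_all add: joint_law_def)
  have rect: "emeasure (joint_law R J \<zeta>) (Pi\<^sub>E J A) =
      ennreal (Re (CLINT \<omega>|R. of_real (\<Prod>k\<in>J. indicator (A k) (\<zeta> k \<omega>))))"
    if R: "prob_space R" and \<zeta>: "\<And>j. j \<in> J \<Longrightarrow> \<zeta> j \<in> borel_measurable R"
      and A: "\<And>j. j \<in> J \<Longrightarrow> A j \<in> sets borel"
    for R :: "'c measure" and \<zeta> A
  proof -
    interpret prob_space R by fact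
    note [measurable] = \<zeta> A
    have set[measurable]: "{\<omega>\<in>space R. \<forall>k\<in>J. \<zeta> k \<omega> \<in> A k} \<in> sets R"
      using J by measurable
    have "(CLINT \<omega>|R. of_real (\<Prod>k\<in>J. indicator (A k) (\<zeta> k \<omega>))) =
        (CLINT \<omega>|R. of_real (indicator {\<omega>\<in>space R. \<forall>k\<in>J. \<zeta> k \<omega> \<in> A k} \<omega>))"
      using J by (intro Bochner_Integration.integral_cong) (auto simp: indicator_def prod_zero_iff prod_eq_1_iff)
    also have "\<dots> = of_real (measure R {\<omega>\<in>space R. \<forall>k\<in>J. \<zeta> k \<omega> \<in> A k})"
      by (subst integral_complex_of_real) auto
    finally have *: "Re (CLINT \<omega>|R. of_real (\<Prod>k\<in>J. indicator (A k) (\<zeta> k \<omega>))) =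
      measure R {\<omega>\<in>space R. \<forall>k\<in>J. \<zeta> k \<omega> \<in> A k}" by simp
    have "emeasure (joint_law R J \<zeta>) (Pi\<^sub>E J A) = emeasure R ((\<lambda>\<omega>. \<lambda>j\<in>J. \<zeta> j \<omega>) -` Pi\<^sub>E J A \<inter> space R)"
      unfolding joint_law_def using A J by (intro emeasure_distr) (auto intro!: sets_PiM_I_finite)
    also have "(\<lambda>\<omega>. \<lambda>j\<in>J. \<zeta> j \<omega>) -` Pi\<^sub>E J A \<inter> space R = {\<omega>\<in>space R. \<forall>k\<in>J. \<zeta> k \<omega> \<in> A k}"
      by (auto simp: PiE_iff)
    finally show ?thesis unfolding * by (simp add: emeasure_eq_measure)
  qed
  show "emeasure (joint_law P J \<xi>) (Pi\<^sub>E J A) = emeasure (joint_law Q J \<eta>) (Pi\<^sub>E J A)"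
    if A: "\<And>j. j \<in> J \<Longrightarrow> A j \<in> sets borel" for A
    using char_determines_rectangle_char[OF P Q J \<xi> \<eta> char order_refl, where A=A and \<theta>="\<lambda>_. 0"] A
      rect[of P \<xi> A] rect[of Q \<eta> A] P Q \<xi> \<eta> by simp
  show "range (\<lambda>_::nat. (\<Pi>\<^sub>E j\<in>J. UNIV)) \<subseteq> prod_algebra J (\<lambda>_. borel :: real measure)"
    using J by (auto intro!: prod_algebraI_finite)
  show "(\<Union>i::nat. \<Pi>\<^sub>E j\<in>J. UNIV) = space (\<Pi>\<^sub>M j\<in>J. borel :: real measure)"
    by (simp add: space_PiM)
  interpret prob_space "joint_law P J \<xi>"
    unfolding joint_law_def by (rule prob_space.prob_space_distr[OF P]) measurable
  show "emeasure (joint_law P J \<xi>) (\<Pi>\<^sub>E j\<in>J. UNIV) \<noteq> \<infinity>" by simp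
qed


section \<open>Stable vectors and increments of the motion\<close>

lemma Hurst_functionD:
  assumes "Hurst_function n H"
  shows "real n - 1 < H t" "H t < real n"
proof -
  obtain a b where "real n - 1 < a" "\<forall>t. a \<le> H t \<and> H t \<le> b" "b < real n"
    using assms by (auto simp: Hurst_function_def)
  then show "real n - 1 < H t" "H t < real n" by (metis less_le_trans, metis le_less_trans)
qed

text \<open>The value of the characteristic function at \<open>\<theta> = 1\<close> determines the scale.\<close>

lemma SaS_scale_eq:
  assumes \<alpha>: "0 < \<alpha>" and \<xi>: "SaS_with_scale P \<alpha> \<sigma> \<xi>"
  shows "SaS_scale P \<alpha> \<xi> = \<sigma>"
  unfolding SaS_scale_def
proof (rule the_equality[where P="\<lambda>\<sigma>. SaS_with_scale P \<alpha> \<sigma> \<xi>", OF \<xi>])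
  fix \<sigma>' assume \<sigma>': "SaS_with_scale P \<alpha> \<sigma>' \<xi>"
  have "complex_of_real (exp (- (\<sigma>' powr \<alpha> * \<bar>1\<bar> powr \<alpha>))) = complex_of_real (exp (- (\<sigma> powr \<alpha> * \<bar>1\<bar> powr \<alpha>)))"
    using \<xi> \<sigma>' unfolding SaS_with_scale_def by metis
  then have "exp (- (\<sigma>' powr \<alpha> * \<bar>1\<bar> powr \<alpha>)) = exp (- (\<sigma> powr \<alpha> * \<bar>1\<bar> powr \<alpha>))"
    by (simp only: of_real_eq_iff)
  then have "\<sigma>' powr \<alpha> = \<sigma> powr \<alpha>" by simp
  then have "(\<sigma>' powr \<alpha>) powr (1 / \<alpha>) = (\<sigma> powr \<alpha>) powr (1 / \<alpha>)" by simp
  then show "\<sigma>' = \<sigma>" using \<alpha> \<xi> \<sigma>' by (simp add: powr_powr SaS_with_scale_def)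
qed

lemma L_alpha_modular_translate: "L_alpha_modular \<alpha> (\<lambda>u. f (u - \<tau>)) = L_alpha_modular \<alpha> f"
  unfolding L_alpha_modular_def
  using lborel_integral_real_affine[of 1 "\<lambda>u. \<bar>f u\<bar> powr \<alpha>" "- \<tau>"] by simp

context SaS_random_measure
begin

lemma SaS_with_scale_stable_integral:
  assumes \<alpha>: "0 < \<alpha>" "\<alpha> \<le> 2" and Y: "has_stable_integral P \<alpha> M f Y"
  shows "SaS_with_scale P \<alpha> (L_alpha_modular \<alpha> f powr (1 / \<alpha>)) Y"
  using char_stable_integral[OF \<alpha> Y] Y \<alpha>(1) L_alpha_modular_nonneg[of \<alpha> f]
  by (simp add: SaS_with_scale_def has_stable_integral_def powr_powr mult.commute)

lemma char_scaled_stable_integral_sum: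
  assumes \<alpha>: "0 < \<alpha>" "\<alpha> \<le> 2" and J: "finite J" and Y: "\<And>j. j \<in> J \<Longrightarrow> has_stable_integral P \<alpha> M (f j) (Y j)"
  shows "(CLINT \<omega>|P. iexp (c * (\<Sum>j\<in>J. \<theta> j * Y j \<omega>))) =
    complex_of_real (exp (- (\<bar>c\<bar> powr \<alpha> * L_alpha_modular \<alpha> (\<lambda>u. \<Sum>j\<in>J. \<theta> j * f j u))))"
proof -
  have "has_stable_integral P \<alpha> M (\<lambda>u. \<Sum>j\<in>J. \<theta> j * f j u) (\<lambda>\<omega>. \<Sum>j\<in>J. \<theta> j * Y j \<omega>)"
    by (rule has_stable_integral_sum[OF \<alpha> J]) (rule Y)
  from char_stable_integral[OF \<alpha> this] show ?thesis .
qed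

text \<open>A linear combination of the vector is the integral of the same combination of the integrands,
  with modular \<open>m\<close>, say. On the product space the
  characteristic function factorises into \<open>exp (-A\<^sup>\<alpha> m)\<close> and \<open>exp (-B\<^sup>\<alpha> m)\<close>, which is
  the characteristic function at frequency \<open>(A\<^sup>\<alpha> + B\<^sup>\<alpha>)\<^bsup>1/\<alpha>\<^esup>\<close>.\<close>

lemma jointly_SaS_stable_integrals:
  assumes \<alpha>: "0 < \<alpha>" "\<alpha> \<le> 2" and J: "finite J" and Y: "\<And>j. j \<in> J \<Longrightarrow> has_stable_integral P \<alpha> M (f j) (Y j)"
  shows "jointly_SaS P \<alpha> J Y"
proof -
  interpret PP: pair_prob_space P P ..
  have PP: "prob_space (P \<Otimes>\<^sub>M P)" by (rule PP.P.prob_space_axioms)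
  have m[measurable]: "Y j \<in> borel_measurable P" if "j \<in> J" for j
    using Y[OF that] by (simp add: has_stable_integral_def)
  have char: "(CLINT \<omega>|P. iexp (c * (\<Sum>j\<in>J. \<theta> j * Y j \<omega>))) =
      complex_of_real (exp (- (\<bar>c\<bar> powr \<alpha> * L_alpha_modular \<alpha> (\<lambda>u. \<Sum>j\<in>J. \<theta> j * f j u))))" for c \<theta>
    by (rule char_scaled_stable_integral_sum[OF \<alpha> J]) (rule Y)
  have pull: "(\<Sum>j\<in>J. \<theta> j * (c * y j)) = c * (\<Sum>j\<in>J. \<theta> j * y j)" for \<theta> y :: "'b \<Rightarrow> real" and c
    by (simp add: sum_distrib_left mult_ac)
  have "joint_law P J (\<lambda>j \<omega>. - Y j \<omega>) = joint_law P J Y"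
  proof (rule joint_law_eqI_char[OF prob_space_axioms prob_space_axioms J])
    fix \<theta>
    have "(\<Sum>j\<in>J. \<theta> j * - Y j \<omega>) = (- 1) * (\<Sum>j\<in>J. \<theta> j * Y j \<omega>)" for \<omega>
      by (simp add: sum_negf)
    then show "(CLINT \<omega>|P. iexp (\<Sum>j\<in>J. \<theta> j * - Y j \<omega>)) = (CLINT \<omega>|P. iexp (\<Sum>j\<in>J. \<theta> j * Y j \<omega>))"
      using char[of "-1" \<theta>] char[of 1 \<theta>] by simp
  qed auto
  moreover have "joint_law (P \<Otimes>\<^sub>M P) J (\<lambda>j (\<omega>', \<omega>''). A * Y j \<omega>' + B * Y j \<omega>'') =
      joint_law P J (\<lambda>j \<omega>. (A powr \<alpha> + B powr \<alpha>) powr (1 / \<alpha>) * Y j \<omega>)" if AB: "0 < A" "0 < B" for A B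
  proof (rule joint_law_eqI_char[OF PP prob_space_axioms J])
    fix \<theta>
    let ?S = "\<lambda>\<omega>. \<Sum>j\<in>J. \<theta> j * Y j \<omega>" and ?m = "L_alpha_modular \<alpha> (\<lambda>u. \<Sum>j\<in>J. \<theta> j * f j u)"
    have [measurable]: "?S \<in> borel_measurable P" by (intro borel_measurable_sum) auto
    have split: "iexp (\<Sum>j\<in>J. \<theta> j * (case z of (\<omega>', \<omega>'') \<Rightarrow> A * Y j \<omega>' + B * Y j \<omega>'')) =
        iexp (A * ?S (fst z)) * iexp (B * ?S (snd z))" for z
    proof -
      have "(\<Sum>j\<in>J. \<theta> j * (case z of (\<omega>', \<omega>'') \<Rightarrow> A * Y j \<omega>' + B * Y j \<omega>'')) = A * ?S (fst z) + B * ?S (snd z)"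
        by (simp add: case_prod_beta distrib_left sum.distrib pull)
      then show ?thesis by (simp only: of_real_add distrib_left exp_add)
    qed
    have int: "integrable (P \<Otimes>\<^sub>M P) (\<lambda>z. iexp (A * ?S (fst z)) * iexp (B * ?S (snd z)))"
      by (rule PP.P.integrable_const_bound[where B=1])
         (auto simp: norm_mult norm_exp_i_times simp del: of_real_mult of_real_sum)
    have "(CLINT z|P \<Otimes>\<^sub>M P. iexp (\<Sum>j\<in>J. \<theta> j * (case z of (\<omega>', \<omega>'') \<Rightarrow> A * Y j \<omega>' + B * Y j \<omega>''))) =
        (CLINT \<omega>'|P. (CLINT \<omega>''|P. iexp (A * ?S \<omega>') * iexp (B * ?S \<omega>'')))"
      unfolding split using PP.integral_fst'[OF int] by simp
    also have "\<dots> = (CLINT \<omega>|P. iexp (A * ?S \<omega>)) * (CLINT \<omega>|P. iexp (B * ?S \<omega>))"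
      by (simp only: integral_mult_right_zero integral_mult_left_zero)
    also have "\<dots> = of_real (exp (- ((A powr \<alpha> + B powr \<alpha>) * ?m)))"
      using AB unfolding char by (simp add: exp_add[symmetric] distrib_right flip: of_real_mult of_real_add)
    also have "\<dots> = (CLINT \<omega>|P. iexp ((A powr \<alpha> + B powr \<alpha>) powr (1 / \<alpha>) * ?S \<omega>))"
      unfolding char using \<alpha> by (simp add: powr_powr)
    finally show "(CLINT z|P \<Otimes>\<^sub>M P. iexp (\<Sum>j\<in>J. \<theta> j * (case z of (\<omega>', \<omega>'') \<Rightarrow> A * Y j \<omega>' + B * Y j \<omega>''))) =
      (CLINT \<omega>|P. iexp (\<Sum>j\<in>J. \<theta> j * ((A powr \<alpha> + B powr \<alpha>) powr (1 / \<alpha>) * Y j \<omega>)))"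
      unfolding pull .
  qed auto
  ultimately show ?thesis using m unfolding jointly_SaS_def by blast
qed

lemma mfsm_has_stable_integral:
  assumes \<alpha>: "1 < \<alpha>" "\<alpha> \<le> 2" and "1 \<le> n" and "Hurst_function n H"
  shows "has_stable_integral P \<alpha> M (mfsm_kernel n \<alpha> H t) (mfsm P \<alpha> M n H t)"
  unfolding mfsm_def
  using \<alpha> assms(3) Hurst_functionD[OF assms(4), of t]
  by (intro has_stable_integral_stable_integral mfsm_kernel_in_L_alpha) auto

lemma nth_increment_mfsm_has_stable_integral:
  assumes \<alpha>: "1 < \<alpha>" "\<alpha> \<le> 2" and n: "1 \<le> n" and H: "Hurst_function n H"
    and c: "\<And>k. k \<le> n \<Longrightarrow> H (t + real k * h) = c"
  shows "has_stable_integral P \<alpha> M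
    (\<lambda>u. 1 / Gamma (c - 1 / \<alpha> + 1) *
      (\<Sum>k\<le>n. (- 1) ^ (n - k) * real (n choose k) * pos_power (real k * h - (u - t)) (c - 1 / \<alpha>)))
    (nth_increment n h (mfsm P \<alpha> M n H) t)"
proof -
  have "has_stable_integral P \<alpha> M
      (\<lambda>u. \<Sum>k\<in>{..n}. ((- 1) ^ (n - k) * real (n choose k)) * mfsm_kernel n \<alpha> H (t + real k * h) u)
      (\<lambda>\<omega>. \<Sum>k\<in>{..n}. ((- 1) ^ (n - k) * real (n choose k)) * mfsm P \<alpha> M n H (t + real k * h) \<omega>)"
    using \<alpha> by (intro has_stable_integral_sum mfsm_has_stable_integral n H) auto
  then show ?thesis
    using c by (subst (asm) nth_increment_mfsm_kernel[where c=c]) (auto simp: nth_increment_def[abs_def])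
qed

end

theorem theorem3p5:
  fixes P :: "'a measure" and M :: "real set \<Rightarrow> 'a \<Rightarrow> real"
    and \<alpha> :: real and n :: nat and H :: "real \<Rightarrow> real"
  assumes "1 < \<alpha>" and "\<alpha> \<le> 2" and "1 \<le> n"
    and "Hurst_function n H"
    and "SaS_random_measure P \<alpha> M"
  shows
    \<comment> \<open>(i)\<close>
    "(\<forall>t. mfsm_kernel n \<alpha> H t \<in> L_alpha \<alpha> \<and>
        has_stable_integral P \<alpha> M (mfsm_kernel n \<alpha> H t) (mfsm P \<alpha> M n H t) \<and>
        (\<forall>Y. has_stable_integral P \<alpha> M (mfsm_kernel n \<alpha> H t) Y \<longrightarrow>
          (AE \<omega> in P. Y \<omega> = mfsm P \<alpha> M n H t \<omega>)) \<and>
        SaS P \<alpha> (mfsm P \<alpha> M n H t)) \<and>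
    \<comment> \<open>(ii)\<close>
     (\<forall>m\<ge>1. \<forall>t \<theta> :: nat \<Rightarrow> real.
        (CLINT \<omega>|P. iexp (\<Sum>j=1..m. \<theta> j * mfsm P \<alpha> M n H (t j) \<omega>)) =
        complex_of_real (exp (- (LINT u|lborel.
          \<bar>\<Sum>j=1..m. \<theta> j * mfsm_kernel n \<alpha> H (t j) u\<bar> powr \<alpha>)))) \<and>
    \<comment> \<open>(iii)\<close>
     (\<forall>m\<ge>1. \<forall>t :: nat \<Rightarrow> real.
        (\<forall>\<theta> :: nat \<Rightarrow> real. SaS P \<alpha> (\<lambda>\<omega>. \<Sum>j=1..m. \<theta> j * mfsm P \<alpha> M n H (t j) \<omega>)) \<and>
        jointly_SaS P \<alpha> {1..m} (\<lambda>j. mfsm P \<alpha> M n H (t j))) \<and>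
    \<comment> \<open>(iv)\<close>
     (\<forall>t. ennreal (SaS_scale P \<alpha> (mfsm P \<alpha> M n H t) powr \<alpha>) =
          (\<integral>\<^sup>+ u. ennreal (\<bar>mfsm_kernel n \<alpha> H t u\<bar> powr \<alpha>) \<partial>lborel) \<and>
        (\<integral>\<^sup>+ u. ennreal (\<bar>mfsm_kernel n \<alpha> H t u\<bar> powr \<alpha>) \<partial>lborel) < \<infinity>) \<and>
    \<comment> \<open>(v), constant H\<close>
     (\<forall>h. (\<exists>c. real n - 1 < c \<and> c < real n \<and> (\<forall>t. H t = c)) \<longrightarrow>
        stationary_process P (nth_increment n h (mfsm P \<alpha> M n H))) \<and>
    \<comment> \<open>(v), functional H: at each time the law is determined by the values of H on the grid;
       where these values coincide, it does not depend on the time either\<close>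
     (\<forall>h H'. Hurst_function n H' \<longrightarrow>
        (\<forall>s t. (\<forall>k\<le>n. H' (s + real k * h) = H (t + real k * h)) \<longrightarrow>
          s = t \<or> (\<forall>k\<le>n. H (t + real k * h) = H t) \<longrightarrow>
          distr P borel (nth_increment n h (mfsm P \<alpha> M n H') s) =
          distr P borel (nth_increment n h (mfsm P \<alpha> M n H) t)))"
proof -
  interpret SaS_random_measure P \<alpha> M by fact
  have \<alpha>: "0 < \<alpha>" "\<alpha> \<le> 2" using assms by auto
  note X = mfsm_has_stable_integral[OF assms(1-4)]
  have kernel: "mfsm_kernel n \<alpha> H t \<in> L_alpha \<alpha>" for t
    using X[of t] by (simp add: has_stable_integral_def)
  have i: "mfsm_kernel n \<alpha> H t \<in> L_alpha \<alpha> \<and>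
        has_stable_integral P \<alpha> M (mfsm_kernel n \<alpha> H t) (mfsm P \<alpha> M n H t) \<and>
        (\<forall>Y. has_stable_integral P \<alpha> M (mfsm_kernel n \<alpha> H t) Y \<longrightarrow>
          (AE \<omega> in P. Y \<omega> = mfsm P \<alpha> M n H t \<omega>)) \<and>
        SaS P \<alpha> (mfsm P \<alpha> M n H t)" for t
    using kernel X SaS_with_scale_stable_integral[OF \<alpha> X] has_stable_integral_unique[OF \<alpha> _ X]
    unfolding SaS_def by blast
  have ii: "(CLINT \<omega>|P. iexp (\<Sum>j=1..m. \<theta> j * mfsm P \<alpha> M n H (t j) \<omega>)) =
        complex_of_real (exp (- (LINT u|lborel.
          \<bar>\<Sum>j=1..m. \<theta> j * mfsm_kernel n \<alpha> H (t j) u\<bar> powr \<alpha>)))" for m and t \<theta> :: "nat \<Rightarrow> real"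
    unfolding L_alpha_modular_def[symmetric] by (intro char_stable_integral_sum \<alpha> X) auto
  have iii: "SaS P \<alpha> (\<lambda>\<omega>. \<Sum>j=1..m. \<theta> j * mfsm P \<alpha> M n H (t j) \<omega>)"
    for m and t \<theta> :: "nat \<Rightarrow> real"
    unfolding SaS_def
    by (rule exI, rule SaS_with_scale_stable_integral[OF \<alpha> has_stable_integral_sum[OF \<alpha>]]) (simp, rule X)
  have iii': "jointly_SaS P \<alpha> {1..m} (\<lambda>j. mfsm P \<alpha> M n H (t j))" for m and t :: "nat \<Rightarrow> real"
    by (rule jointly_SaS_stable_integrals[OF \<alpha> _ X]) simp
  have iv: "ennreal (SaS_scale P \<alpha> (mfsm P \<alpha> M n H t) powr \<alpha>) =
          (\<integral>\<^sup>+ u. ennreal (\<bar>mfsm_kernel n \<alpha> H t u\<bar> powr \<alpha>) \<partial>lborel) \<and>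
        (\<integral>\<^sup>+ u. ennreal (\<bar>mfsm_kernel n \<alpha> H t u\<bar> powr \<alpha>) \<partial>lborel) < \<infinity>" for t
  proof -
    have "(\<integral>\<^sup>+ u. ennreal (\<bar>mfsm_kernel n \<alpha> H t u\<bar> powr \<alpha>) \<partial>lborel) =
        ennreal (L_alpha_modular \<alpha> (mfsm_kernel n \<alpha> H t))"
      unfolding L_alpha_modular_def
      by (rule nn_integral_eq_integral[OF L_alpha_integrable[OF kernel]]) simp
    moreover have "SaS_scale P \<alpha> (mfsm P \<alpha> M n H t) powr \<alpha> = L_alpha_modular \<alpha> (mfsm_kernel n \<alpha> H t)"
      using SaS_scale_eq[OF \<alpha>(1) SaS_with_scale_stable_integral[OF \<alpha> X]] \<alpha>(1)
      by (simp add: powr_powr L_alpha_modular_nonneg)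
    ultimately show ?thesis by simp
  qed
  have v: "stationary_process P (nth_increment n h (mfsm P \<alpha> M n H))"
    if "\<exists>c. real n - 1 < c \<and> c < real n \<and> (\<forall>t. H t = c)" for h
  proof -
    obtain c where c: "\<And>t. H t = c" using \<open>\<exists>c. _\<close> by blast
    let ?Y = "nth_increment n h (mfsm P \<alpha> M n H)"
    define G where "G v = 1 / Gamma (c - 1 / \<alpha> + 1) *
      (\<Sum>k\<le>n. (- 1) ^ (n - k) * real (n choose k) * pos_power (real k * h - v) (c - 1 / \<alpha>))" for v
    have Y: "has_stable_integral P \<alpha> M (\<lambda>u. G (u - t)) (?Y t)" for t
      unfolding G_def by (rule nth_increment_mfsm_has_stable_integral[OF assms(1-4)]) (rule c)
    have m: "?Y t \<in> borel_measurable P" for t using Y[of t] by (simp add: has_stable_integral_def)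
    have "joint_law P J (\<lambda>t. ?Y (t + \<tau>)) = joint_law P J ?Y" if J: "finite J" for J \<tau>
    proof (rule joint_law_eqI_char[OF prob_space_axioms prob_space_axioms J m m])
      fix \<theta>
      have "(CLINT \<omega>|P. iexp (\<Sum>t\<in>J. \<theta> t * ?Y (t + \<tau>) \<omega>)) =
          complex_of_real (exp (- L_alpha_modular \<alpha> (\<lambda>u. \<Sum>t\<in>J. \<theta> t * G (u - (t + \<tau>)))))"
        by (rule char_stable_integral_sum[OF \<alpha> J Y])
      also have "(\<lambda>u. \<Sum>t\<in>J. \<theta> t * G (u - (t + \<tau>))) = (\<lambda>u. (\<lambda>v. \<Sum>t\<in>J. \<theta> t * G (v - t)) (u - \<tau>))"
        by (simp add: algebra_simps)
      also have "L_alpha_modular \<alpha> \<dots> = L_alpha_modular \<alpha> (\<lambda>v. \<Sum>t\<in>J. \<theta> t * G (v - t))"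
        by (rule L_alpha_modular_translate)
      also have "complex_of_real (exp (- \<dots>)) = (CLINT \<omega>|P. iexp (\<Sum>t\<in>J. \<theta> t * ?Y t \<omega>))"
        by (rule char_stable_integral_sum[OF \<alpha> J Y, symmetric])
      finally show "(CLINT \<omega>|P. iexp (\<Sum>t\<in>J. \<theta> t * ?Y (t + \<tau>) \<omega>)) =
        (CLINT \<omega>|P. iexp (\<Sum>t\<in>J. \<theta> t * ?Y t \<omega>))" .
    qed
    with m show ?thesis by (simp add: stationary_process_def)
  qed
  have v': "distr P borel (nth_increment n h (mfsm P \<alpha> M n H') s) =
          distr P borel (nth_increment n h (mfsm P \<alpha> M n H) t)"
    if H': "Hurst_function n H'" and grid: "\<forall>k\<le>n. H' (s + real k * h) = H (t + real k * h)"
      and alt: "s = t \<or> (\<forall>k\<le>n. H (t + real k * h) = H t)" for h H' s t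
    using alt
  proof
    \<comment> \<open>equal kernels at each grid point, hence literally the same chosen versions of the integrals\<close>
    assume "s = t"
    with grid have "mfsm P \<alpha> M n H' (s + real k * h) = mfsm P \<alpha> M n H (t + real k * h)" if "k \<le> n" for k
      using that by (simp add: mfsm_def mfsm_kernel_def[abs_def])
    then have "nth_increment n h (mfsm P \<alpha> M n H') s = nth_increment n h (mfsm P \<alpha> M n H) t"
      by (auto simp: nth_increment_def fun_eq_iff intro!: sum.cong)
    then show ?thesis by simp
  next
    assume const: "\<forall>k\<le>n. H (t + real k * h) = H t"
    define G where "G v = 1 / Gamma (H t - 1 / \<alpha> + 1) *
      (\<Sum>k\<le>n. (- 1) ^ (n - k) * real (n choose k) * pos_power (real k * h - v) (H t - 1 / \<alpha>))" for v
    have Z: "has_stable_integral P \<alpha> M (\<lambda>u. G (u - t)) (nth_increment n h (mfsm P \<alpha> M n H) t)"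
      unfolding G_def by (rule nth_increment_mfsm_has_stable_integral[OF assms(1-4)]) (use const in auto)
    have Z': "has_stable_integral P \<alpha> M (\<lambda>u. G (u - s)) (nth_increment n h (mfsm P \<alpha> M n H') s)"
      unfolding G_def by (rule nth_increment_mfsm_has_stable_integral[OF assms(1-3) H']) (use const grid in auto)
    have m: "nth_increment n h (mfsm P \<alpha> M n H) t \<in> borel_measurable P"
      "nth_increment n h (mfsm P \<alpha> M n H') s \<in> borel_measurable P"
      using Z Z' by (auto simp: has_stable_integral_def)
    show ?thesis
    proof (rule Levy_uniqueness)
      show "char (distr P borel (nth_increment n h (mfsm P \<alpha> M n H') s)) =
          char (distr P borel (nth_increment n h (mfsm P \<alpha> M n H) t))"
        using m char_stable_integral[OF \<alpha> Z] char_stable_integral[OF \<alpha> Z']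
        by (simp add: char_def integral_distr fun_eq_iff L_alpha_modular_translate)
    qed (use m in auto)
  qed
  show ?thesis using i ii iii iii' iv v v' by blast
qed

end
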